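(* Let $\mathcal{H}$ be a real Hilbert space, $A:\mathcal{H}\rightrightarrows\mathcal{H}$ a maximally monotone operator and $z\in\mathcal{H}$. Let $m$ be a strictly positive integer and, for every $i\in\{1,\ldots,m\}$, let $\mathcal{G}_i$ be a real Hilbert space, $r_i\in\mathcal{G}_i$, let $B_i:\mathcal{G}_i\rightrightarrows\mathcal{G}_i$ and $D_i:\mathcal{G}_i\rightrightarrows\mathcal{G}_i$ be maximally monotone operators and let $L_i:\mathcal{H}\rightarrow\mathcal{G}_i$ be a nonzero linear continuous operator. Suppose that $$z\in\operatorname{ran}\Big(A+\sum_{i=1}^m L_i^*(B_i\,\square\, D_i)(L_i\cdot-r_i)\Big).$$ Let $x_0,x_1\in\mathcal{H}$, $v_{i,0},v_{i,1}\in\mathcal{G}_i$, $i=1,\ldots,m$, and let $\tau>0$, $\sigma_i>0$, $i=1,\ldots,m$, be such that $$\tau\sum_{i=1}^m\sigma_i\|L_i\|^2<4.$$ Let $(\alpha_n)_{n\geq 1}$ be a nondecreasing sequence of real numbers with $\alpha_1=0$ and $0\leq\alpha_n\leq\alpha<1$ for every $n\geq1$ (with $\alpha$ a real number), and let $\lambda,\sigma,\delta>0$ and the real sequence $(\lambda_n)_{n\geq1}$ be such that $$\delta>\frac{\alpha^2(1+\alpha)+\alpha\sigma}{1-\alpha^2}\quad\text{and}\quad 0<\lambda\leq\lambda_n\leq 2\,\frac{\delta-\alpha\big[\alpha(1+\alpha)+\alpha\delta+\sigma\big]}{\delta\big[1+\alpha(1+\alpha)+\alpha\delta+\sigma\big]}\quad\forall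 n\geq 1.$$ Define sequences by setting, for every $n\geq 1$ (successively, and with $i$ ranging over $1,\ldots,m$), $$\begin{aligned} p_{1,n}&=J_{\tau A}\Big(x_n+\alpha_n(x_n-x_{n-1})-\tfrac{\tau}{2}\sum_{i=1}^m L_i^*\big(v_{i,n}+\alpha_n(v_{i,n}-v_{i,n-1})\big)+\tau z\Big),\\ w_{1,n}&=2p_{1,n}-x_n-\alpha_n(x_n-x_{n-1}),\\ p_{2,i,n}&=J_{\sigma_iB_i^{-1}}\Big(v_{i,n}+\alpha_n(v_{i,n}-v_{i,n-1})+\tfrac{\sigma_i}{2}L_iw_{1,n}-\sigma_ir_i\Big),\\ w_{2,i,n}&=2p_{2,i,n}-v_{i,n}-\alpha_n(v_{i,n}-v_{i,n-1}),\\ z_{1,n}&=w_{1,n}-\tfrac{\tau}{2}\sum_{i=1}^m L_i^*w_{2,i,n},\\ x_{n+1}&=x_n+\alpha_n(x_n-x_{n-1})+\lambda_n(z_{1,n}-p_{1,n}),\\ z_{2,i,n}&=J_{\sigma_iD_i^{-1}}\Big(w_{2,i,n}+\tfrac{\sigma_i}{2}L_i(2z_{1,n}-w_{1,n})\Big),\\ v_{i,n+1}&=v_{i,n}+\alpha_n(v_{i,n}-v_{i,n-1})+\lambda_n(z_{2,i,n}-p_{2,i,n}). \end{aligned}$$ Then there exists $(\overline{x},\overline{v}_1,\ldots,\overline{v}_m)\in\mathcal{H}\times\mathcal{G}_1\times\cdots\times\mathcal{G}_m$ such that the following statements are true: (i) By setting $$\overline{p}_1=J_{\tau A}\Big(\overline{x}-\tfrac{\tau}{2}\sum_{i=1}^mL_i^*\overline{v}_i+\tau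 z\Big),\qquad \overline{p}_{2,i}=J_{\sigma_iB_i^{-1}}\Big(\overline{v}_i+\tfrac{\sigma_i}{2}L_i(2\overline{p}_1-\overline{x})-\sigma_ir_i\Big),\ i=1,\ldots,m,$$ the element $(\overline{p}_1,\overline{p}_{2,1},\ldots,\overline{p}_{2,m})$ is a primal-dual solution (as defined in the context); (ii) $\sum_{n\in\mathbb{N}}\|x_{n+1}-x_n\|^2<+\infty$ and $\sum_{n\in\mathbb{N}}\|v_{i,n+1}-v_{i,n}\|^2<+\infty$, $i=1,\ldots,m$; (iii) $(x_n,v_{1,n},\ldots,v_{m,n})_{n\in\mathbb{N}}$ converges weakly to $(\overline{x},\overline{v}_1,\ldots,\overline{v}_m)$; (iv) $(p_{1,n}-z_{1,n},p_{2,1,n}-z_{2,1,n},\ldots,p_{2,m,n}-z_{2,m,n})\rightarrow0$ as $n\rightarrow+\infty$; (v) $(p_{1,n},p_{2,1,n},\ldots,p_{2,m,n})_{n\geq1}$ converges weakly to $(\overline{p}_1,\overline{p}_{2,1},\ldots,\overline{p}_{2,m})$; (vi) $(z_{1,n},z_{2,1,n},\ldots,z_{2,m,n})_{n\geq1}$ converges weakly to $(\overline{p}_1,\overline{p}_{2,1},\ldots,\overline{p}_{2,m})$; (vii) if $A$ and $B_i^{-1}$, $i=1,\ldots,m$, are uniformly monotone, then $(p_{1,n},p_{2,1,n},\ldots,p_{2,m,n})_{n\geq1}$ and $(z_{1,n},z_{2,1,n},\ldots,z_{2,m,n})_{n\geq1}$ converge strongly to the unique primal-dual solution $(\overline{p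}_1,\overline{p}_{2,1},\ldots,\overline{p}_{2,m})$.
   Context: $\mathbb{N}=\{0,1,2,\ldots\}$. For a set-valued operator $A:\mathcal{H}\rightrightarrows\mathcal{H}$ on a real Hilbert space: $\operatorname{Gr}A=\{(x,u):u\in Ax\}$, $\operatorname{ran}A=\bigcup_{x\in\mathcal{H}}Ax$, and $A^{-1}$ is defined by $(u,x)\in\operatorname{Gr}A^{-1}$ iff $(x,u)\in\operatorname{Gr}A$. $A$ is monotone if $\langle x-y,u-v\rangle\geq0$ for all $(x,u),(y,v)\in\operatorname{Gr}A$, and maximally monotone if moreover its graph has no proper monotone extension. The resolvent is $J_A=(\operatorname{Id}+A)^{-1}$ (single-valued and everywhere defined if $A$ is maximally monotone). $A$ is uniformly monotone if there is an increasing function $\phi_A:[0,+\infty)\to[0,+\infty]$ vanishing only at $0$ with $\langle x-y,u-v\rangle\geq\phi_A(\|x-y\|)$ for all $(x,u),(y,v)\in\operatorname{Gr}A$. The parallel sum of two operators is $B\,\square\,D=(B^{-1}+D^{-1})^{-1}$. $L^*$ denotes the adjoint of a linear continuous operator $L$ and $\|L\|$ its operator norm. The operator $A+\sum_{i=1}^m L_i^*(B_i\,\square\,D_i)(L_i\cdot-r_i)$ maps $x$ to $Ax+\sum_{i=1}^mL_i^*\big((B_i\,\square\,D_i)(L_ix-r_i)\big)$. The underlying primal problem is to find $\overline{x}\in\mathcal{H}$ with $z\in A\overline{x}+\sum_{i=1}^mL_i^*(B_i\,\square\,D_i)(L_i\overline{x}-r_i)$, and the dual problem is to find $(\overline{v}_1,\ldots,\overline{v}_m)\in\mathcal{G}_1\times\cdots\times\mathcal{G}_m$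 for which there exists $x\in\mathcal{H}$ with $z-\sum_{i=1}^mL_i^*\overline{v}_i\in Ax$ and $\overline{v}_i\in(B_i\,\square\,D_i)(L_ix-r_i)$, $i=1,\ldots,m$. An element $(\overline{x},\overline{v}_1,\ldots,\overline{v}_m)\in\mathcal{H}\times\mathcal{G}_1\times\cdots\times\mathcal{G}_m$ is called a primal-dual solution if $z-\sum_{i=1}^mL_i^*\overline{v}_i\in A\overline{x}$ and $\overline{v}_i\in(B_i\,\square\,D_i)(L_i\overline{x}-r_i)$ for $i=1,\ldots,m$. The product space $\mathcal{H}\times\mathcal{G}_1\times\cdots\times\mathcal{G}_m$ carries the inner product $\langle(x,v_1,\ldots,v_m),(y,q_1,\ldots,q_m)\rangle=\langle x,y\rangle+\sum_{i=1}^m\langle v_i,q_i\rangle$. *)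

theory Defs
  imports "HOL-Analysis.Analysis"
begin

text \<open>
  Set-valued operators are functions \<open>A :: 'a \<Rightarrow> 'b set\<close>; sums of sets are
  Minkowski sums (so a sum with an empty summand is empty, and the empty sum is \<open>{0}\<close>).

  The Hilbert spaces \<open>\<G>\<^sub>1, \<dots>, \<G>\<^sub>m\<close> may differ from one another. They are represented as
  closed subspaces \<open>G i\<close> of one ambient real Hilbert space \<open>'g\<close>, with \<open>i\<close> ranging over a
  finite index type \<open>'m\<close>. This loses no generality, since the spaces embed isometrically
  into their Hilbert direct sum. An operator on \<open>G i\<close> is a set-valued function whose graph is
  contained in \<open>G i \<times> G i\<close>; its values at points outside \<open>G i\<close> are empty.
\<close>

definition Gr :: "('a \<Rightarrow> 'b set) \<Rightarrow> ('a \<times> 'b) set" where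
  "Gr A = {(x, u). u \<in> A x}"

definition range_op :: "('a \<Rightarrow> 'b set) \<Rightarrow> 'b set" where
  "range_op A = (\<Union>x. A x)"

definition inverse_op :: "('a \<Rightarrow> 'b set) \<Rightarrow> 'b \<Rightarrow> 'a set" where
  "inverse_op A u = {x. (x, u) \<in> Gr A}"

definition scale_op :: "real \<Rightarrow> ('a \<Rightarrow> 'b::real_vector set) \<Rightarrow> 'a \<Rightarrow> 'b set" where
  "scale_op c A x = (\<lambda>u. c *\<^sub>R u) ` A x"

definition parallel_sum ::
    "('a::real_vector \<Rightarrow> 'b set) \<Rightarrow> ('a \<Rightarrow> 'b set) \<Rightarrow> 'a \<Rightarrow> 'b set" where
  "parallel_sum B D = inverse_op (\<lambda>u. inverse_op B u + inverse_op D u)"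

definition monotone_op :: "('a::real_inner \<Rightarrow> 'a set) \<Rightarrow> bool" where
  "monotone_op A \<longleftrightarrow> (\<forall>(x, u) \<in> Gr A. \<forall>(y, v) \<in> Gr A. (x - y) \<bullet> (u - v) \<ge> 0)"

text \<open>Maximality is relative to the space \<open>S\<close> on which the operator lives.\<close>

definition maximally_monotone_on :: "'a::real_inner set \<Rightarrow> ('a \<Rightarrow> 'a set) \<Rightarrow> bool" where
  "maximally_monotone_on S A \<longleftrightarrow>
     Gr A \<subseteq> S \<times> S \<and> monotone_op A \<and>
     (\<forall>A'. Gr A' \<subseteq> S \<times> S \<and> monotone_op A' \<and> Gr A \<subseteq> Gr A' \<longrightarrow> Gr A' = Gr A)"

definition uniformly_monotone :: "('a::real_inner \<Rightarrow> 'a set) \<Rightarrow> bool" where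
  "uniformly_monotone A \<longleftrightarrow>
     (\<exists>\<phi> :: real \<Rightarrow> ereal.
        mono_on {0..} \<phi> \<and> (\<forall>t\<ge>0. 0 \<le> \<phi> t) \<and> (\<forall>t\<ge>0. \<phi> t = 0 \<longleftrightarrow> t = 0) \<and>
        (\<forall>(x, u) \<in> Gr A. \<forall>(y, v) \<in> Gr A. ereal ((x - y) \<bullet> (u - v)) \<ge> \<phi> (norm (x - y))))"

text \<open>
  The set \<open>(Id + A)\<^sup>-\<^sup>1 x\<close> is a singleton for every \<open>x\<close> in the underlying space when \<open>A\<close> is
  maximally monotone on that space; \<open>resolvent A x\<close> denotes its element.
\<close>

definition resolvent :: "('a::real_vector \<Rightarrow> 'a set) \<Rightarrow> 'a \<Rightarrow> 'a" where
  "resolvent A x = (THE p. p \<in> inverse_op (\<lambda>y. {y} + A y) x)"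

text \<open>
  For \<open>L i :: 'h \<Rightarrow> 'g\<close> with range in \<open>G i\<close>, the library's \<open>adjoint (L i)\<close> is defined on all
  of \<open>'g\<close>; its restriction to \<open>G i\<close> is the adjoint of \<open>L i\<close> as a map into \<open>G i\<close>.
\<close>

definition primal_op ::
    "('h::real_inner \<Rightarrow> 'h set) \<Rightarrow> ('m::finite \<Rightarrow> 'g::real_inner \<Rightarrow> 'g set) \<Rightarrow>
     ('m \<Rightarrow> 'g \<Rightarrow> 'g set) \<Rightarrow> ('m \<Rightarrow> 'h \<Rightarrow> 'g) \<Rightarrow> ('m \<Rightarrow> 'g) \<Rightarrow> 'h \<Rightarrow> 'h set" where
  "primal_op A B D L r x =
     A x + (\<Sum>i\<in>UNIV. adjoint (L i) ` parallel_sum (B i) (D i) (L i x - r i))"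

definition primal_dual_solution ::
    "('h::real_inner \<Rightarrow> 'h set) \<Rightarrow> ('m::finite \<Rightarrow> 'g::real_inner \<Rightarrow> 'g set) \<Rightarrow>
     ('m \<Rightarrow> 'g \<Rightarrow> 'g set) \<Rightarrow> ('m \<Rightarrow> 'h \<Rightarrow> 'g) \<Rightarrow> ('m \<Rightarrow> 'g) \<Rightarrow> 'h \<Rightarrow> 'h \<times> ('g ^ 'm) \<Rightarrow> bool" where
  "primal_dual_solution A B D L r z = (\<lambda>(x, v).
     z - (\<Sum>i\<in>UNIV. adjoint (L i) (v $ i)) \<in> A x \<and>
     (\<forall>i. v $ i \<in> parallel_sum (B i) (D i) (L i x - r i)))"

text \<open>
  The product space \<open>\<H> \<times> \<G>\<^sub>1 \<times> \<dots> \<times> \<G>\<^sub>m\<close>. The library's inner product on \<open>'h \<times> ('g ^ 'm)\<close> is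
  \<open>x \<bullet> y + (\<Sum>i\<in>UNIV. v $ i \<bullet> q $ i)\<close>, as required.
\<close>

definition product_space :: "('m::finite \<Rightarrow> 'g set) \<Rightarrow> ('h \<times> ('g ^ 'm)) set" where
  "product_space G = {(x, v). \<forall>i. v $ i \<in> G i}"

text \<open>
  Weak convergence in a Hilbert space \<open>S\<close> (a closed subspace of the ambient space).
  Membership of the sequence is only required eventually, so that
  sequences indexed by \<open>n \<ge> 1\<close> can be given as functions on \<open>nat\<close>.
\<close>

definition weakly_converges_on ::
    "'a::real_inner set \<Rightarrow> (nat \<Rightarrow> 'a) \<Rightarrow> 'a \<Rightarrow> bool" where
  "weakly_converges_on S X l \<longleftrightarrow>
     l \<in> S \<and> (\<forall>\<^sub>F n in sequentially. X n \<in> S) \<and>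
     (\<forall>y\<in>S. (\<lambda>n. X n \<bullet> y) \<longlonglongrightarrow> l \<bullet> y)"

end

theory Submission
  imports Defs
begin

text \<open>The iteration is an inertial Douglas--Rachford method in the product space. Write
\<open>M (x, v) = (A x - z, B\<^sub>i\<inverse> v\<^sub>i + r\<^sub>i)\<close>, \<open>Q (x, v) = (0, D\<^sub>i\<inverse> v\<^sub>i)\<close> and let
\<open>K (x, v) = (\<Sum>i. L\<^sub>i\<^sup>* v\<^sub>i, - L\<^sub>i x)\<close> be the skew coupling. Primal-dual solutions are the zeros of
\<open>M + Q + K\<close>, split as \<open>(M + K/2) + (Q + K/2)\<close>. With the self-adjoint map
\<open>V (x, v) = (x/\<tau> - (\<Sum>i. L\<^sub>i\<^sup>* v\<^sub>i)/2, v\<^sub>i/\<sigma>\<^sub>i - L\<^sub>i x/2)\<close>, which is coercive because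
\<open>\<tau> \<Sum>i. \<sigma>\<^sub>i \<parallel>L\<^sub>i\<parallel>\<^sup>2 < 4\<close>, the inclusions \<open>V (s - p) \<in> (M + K/2) p\<close> and \<open>V (s - p) \<in> (Q + K/2) p\<close>
become triangular and are solved by one evaluation of each single resolvent. Their solution maps
\<open>J1\<close> and \<open>J2\<close> are firmly nonexpansive for the inner product \<open>\<langle>s, V t\<rangle>\<close>, since the skew map \<open>K\<close>
satisfies \<open>\<langle>s, K s\<rangle> = 0\<close> (\<open>skew_part_cancels\<close>), and the algorithm is
\<open>u\<^sub>n\<^sub>+\<^sub>1 = w\<^sub>n + \<lambda>\<^sub>n (J2 (2 p\<^sub>n - w\<^sub>n) - p\<^sub>n)\<close> with \<open>p\<^sub>n = J1 w\<^sub>n\<close> and the extrapolated point \<open>w\<^sub>n\<close>.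

Convergence is then a statement about two firmly nonexpansive maps. A relaxed step decreases the
squared distance to every fixed point (\<open>relaxed_step_descent\<close>); the upper bound on \<open>\<lambda>\<^sub>n\<close> is
what is needed to absorb the inertial terms into a Lyapunov function
(\<open>inertial_coefficients_bound\<close>, \<open>inertial_descent\<close>). Hence increments are square summable,
residuals tend to zero, and distances to fixed points converge. The weak cluster points of
\<open>(w\<^sub>n, p\<^sub>n)\<close> have the form \<open>(s, J1 s)\<close> with \<open>J2 (2 J1 s - s) = J1 s\<close> (\<open>weak_cluster_point\<close>), and Opial's
argument makes the cluster point unique (\<open>weak_convergence\<close>). The same pair of inequalities shows that the
monotonicity gap at \<open>p\<^sub>n\<close> tends to zero, which gives strong convergence under uniform monotonicity.

The Hilbert space facts all come from one variational lemma, \<open>convex_minimizing_limit\<close>: it yields the Riesz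
representation (hence adjoints and weak limits) and Minty's theorem (hence resolvents). Weak
compactness is Tychonoff's theorem for the maps \<open>y \<mapsto> \<langle>X\<^sub>n, y\<rangle>\<close>, expressed with filters instead of
subsequences.\<close>

section \<open>Riesz representation, adjoints and resolvents\<close>

text \<open>The function \<open>(p, c) \<mapsto> \<parallel>p\<parallel>\<^sup>2 + c\<close> is strongly convex in its first argument, so by the parallelogram
identity the first components of a minimizing sequence form a Cauchy sequence; no compactness
is involved, and the infimum need not be attained on \<open>K\<close>. The inequality is the first-order optimality
condition at the limit, with the infimum replaced by its lower bound \<open>m\<close>. For the graph of a linear functional it becomes the Riesz representation, and for
a monotone operator it becomes Minty's theorem.\<close>

lemma convex_minimizing_limit:
  fixes K :: "('a::{real_inner,banach} \<times> real) set"
  assumes conv: "convex K" and ne: "K \<noteq> {}"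
    and lower: "\<And>p c. (p, c) \<in> K \<Longrightarrow> m \<le> (norm p)\<^sup>2 + c"
  obtains p where "p \<in> closure (fst ` K)"
    and "\<And>q c. (q, c) \<in> K \<Longrightarrow> (norm p)\<^sup>2 + m \<le> 2 * (p \<bullet> q) + c"
proof -
  define Q where "Q = (\<lambda>k::'a \<times> real. (norm (fst k))\<^sup>2 + snd k)"
  define \<mu> where "\<mu> = Inf (Q ` K)"
  have bdd: "bdd_below (Q ` K)"
    using lower by (intro bdd_belowI[of _ m]) (auto simp: Q_def)
  have \<mu>_le: "\<mu> \<le> Q k" if "k \<in> K" for k
    unfolding \<mu>_def using bdd that by (intro cInf_lower) auto
  have m_le: "m \<le> \<mu>"
    unfolding \<mu>_def using ne lower by (intro cInf_greatest) (auto simp: Q_def)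
  have "\<exists>k\<in>K. Q k < \<mu> + 1 / real (Suc n)" for n
    using cInf_lessD[of "Q ` K" "\<mu> + 1 / real (Suc n)"] ne unfolding \<mu>_def by auto
  then obtain k where k: "\<And>n. k n \<in> K" "\<And>n. Q (k n) < \<mu> + 1 / real (Suc n)"
    by metis
  define p where "p = (\<lambda>n. fst (k n))"
  have gap: "(norm (p i - p j))\<^sup>2 \<le> 2 * (1 / real (Suc i) + 1 / real (Suc j))" for i j
  proof -
    have "(1/2) *\<^sub>R k i + (1/2) *\<^sub>R k j \<in> K"
      using conv k by (intro convexD) auto
    then have "\<mu> \<le> Q ((1/2) *\<^sub>R k i + (1/2) *\<^sub>R k j)" by (rule \<mu>_le)
    also have "\<dots> = (Q (k i) + Q (k j)) / 2 - (norm (p i - p j))\<^sup>2 / 4"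
      unfolding Q_def p_def
      by (simp add: power2_norm_eq_inner inner_simps inner_commute field_simps)
    finally show ?thesis using k(2)[of i] k(2)[of j] by argo
  qed
  have "Cauchy p"
  proof (rule metric_CauchyI)
    fix e :: real assume "e > 0"
    then obtain N where N: "1 / real (Suc N) < e\<^sup>2 / 4"
      using reals_Archimedean[of "e\<^sup>2 / 4"] by (auto simp: inverse_eq_divide)
    have "dist (p i) (p j) < e" if "N \<le> i" "N \<le> j" for i j
    proof -
      have "1 / real (Suc i) \<le> 1 / real (Suc N)" "1 / real (Suc j) \<le> 1 / real (Suc N)"
        using that by (auto intro!: divide_left_mono)
      then have "(norm (p i - p j))\<^sup>2 < e\<^sup>2" using gap[of i j] N by argo
      then show ?thesis using \<open>e > 0\<close> by (simp add: dist_norm power_less_imp_less_base)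
    qed
    then show "\<exists>M. \<forall>i\<ge>M. \<forall>j\<ge>M. dist (p i) (p j) < e" by blast
  qed
  then obtain P where P: "p \<longlonglongrightarrow> P" using Cauchy_convergent convergent_def by blast
  have Qlim: "(\<lambda>n. Q (k n)) \<longlonglongrightarrow> \<mu>"
  proof (rule tendsto_sandwich[of "\<lambda>_. \<mu>" _ _ "\<lambda>n. \<mu> + 1 / real (Suc n)"])
    show "(\<lambda>n. \<mu> + 1 / real (Suc n)) \<longlonglongrightarrow> \<mu>"
      using tendsto_add[OF tendsto_const LIMSEQ_inverse_real_of_nat, of \<mu>]
      by (simp add: inverse_eq_divide)
    show "\<forall>\<^sub>F n in sequentially. \<mu> \<le> Q (k n)"
      using k(1) \<mu>_le by (intro always_eventually allI) blast
    show "\<forall>\<^sub>F n in sequentially. Q (k n) \<le> \<mu> + 1 / real (Suc n)"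
      using k(2) less_imp_le by (intro always_eventually allI) blast
  qed simp
  have snd_lim: "(\<lambda>n. snd (k n)) \<longlonglongrightarrow> \<mu> - (norm P)\<^sup>2"
  proof -
    have "(\<lambda>n. Q (k n) - (norm (p n))\<^sup>2) \<longlonglongrightarrow> \<mu> - (norm P)\<^sup>2"
      by (intro tendsto_intros Qlim P)
    then show ?thesis by (simp add: Q_def p_def)
  qed
  show ?thesis
  proof
    show "P \<in> closure (fst ` K)"
      using P k(1) unfolding closure_sequential p_def
      by (intro exI[of _ "\<lambda>n. fst (k n)"]) auto
    fix q c assume qc: "(q, c) \<in> K"
    \<comment> \<open>Move from the minimizing sequence a fraction \<open>t\<close> towards \<open>(q, c)\<close>, pass to the limit, and divide by \<open>t\<close>.\<close>
    have ineq: "0 \<le> 2 * (P \<bullet> q) - (norm P)\<^sup>2 - \<mu> + c + t * (norm (q - P))\<^sup>2"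
      if t: "t > 0" "t < 1" for t
    proof -
      have "\<mu> \<le> (norm ((1 - t) *\<^sub>R p n + t *\<^sub>R q))\<^sup>2 + ((1 - t) * snd (k n) + t * c)" for n
      proof -
        have "(1 - t) *\<^sub>R k n + t *\<^sub>R (q, c) \<in> K"
          using conv k qc t by (intro convexD) auto
        from \<mu>_le[OF this] show ?thesis by (simp add: Q_def p_def)
      qed
      moreover have "(\<lambda>n. (norm ((1 - t) *\<^sub>R p n + t *\<^sub>R q))\<^sup>2 + ((1 - t) * snd (k n) + t * c))
          \<longlonglongrightarrow> (norm ((1 - t) *\<^sub>R P + t *\<^sub>R q))\<^sup>2 + ((1 - t) * (\<mu> - (norm P)\<^sup>2) + t * c)"
        by (intro tendsto_intros P snd_lim)
      ultimately have "\<mu> \<le> (norm ((1 - t) *\<^sub>R P + t *\<^sub>R q))\<^sup>2 + ((1 - t) * (\<mu> - (norm P)\<^sup>2) + t * c)"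
        by (intro LIMSEQ_le_const) auto
      also have "\<dots> = \<mu> + t * (2 * (P \<bullet> q) - (norm P)\<^sup>2 - \<mu> + c + t * (norm (q - P))\<^sup>2)"
        by (simp add: power2_norm_eq_inner inner_simps inner_commute algebra_simps)
      finally show ?thesis using t(1) by (simp add: zero_le_mult_iff)
    qed
    have "((\<lambda>t. 2 * (P \<bullet> q) - (norm P)\<^sup>2 - \<mu> + c + t * (norm (q - P))\<^sup>2) \<longlongrightarrow>
        2 * (P \<bullet> q) - (norm P)\<^sup>2 - \<mu> + c + 0 * (norm (q - P))\<^sup>2) (at_right 0)"
      by (intro tendsto_intros)
    moreover have "\<forall>\<^sub>F t in at_right 0. 0 \<le> 2 * (P \<bullet> q) - (norm P)\<^sup>2 - \<mu> + c + t * (norm (q - P))\<^sup>2"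
      by (rule eventually_mono[OF eventually_at_right_real[of 0 1]]) (auto intro: ineq)
    ultimately have "0 \<le> 2 * (P \<bullet> q) - (norm P)\<^sup>2 - \<mu> + c + 0 * (norm (q - P))\<^sup>2"
      by (rule tendsto_lowerbound) simp
    then show "(norm P)\<^sup>2 + m \<le> 2 * (P \<bullet> q) + c" using m_le by simp
  qed
qed

text \<open>Minimizing \<open>\<parallel>x\<parallel>\<^sup>2 - 2 f x\<close> over \<open>S\<close> produces a point \<open>w\<close> at which the linear functional
\<open>y \<mapsto> \<langle>w, y\<rangle> - f y\<close> is bounded below, hence zero. Working on a closed subspace keeps \<open>w\<close> inside it,
so that weak limits of sequences in \<open>S\<close> stay in \<open>S\<close>.\<close>

lemma riesz_representation_on:
  fixes S :: "'a::{real_inner,banach} set"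
  assumes S: "subspace S" "closed S"
    and add: "\<And>x y. x \<in> S \<Longrightarrow> y \<in> S \<Longrightarrow> f (x + y) = f x + f y"
    and scale: "\<And>c x. x \<in> S \<Longrightarrow> f (c *\<^sub>R x) = c * f x"
    and bound: "\<And>x. x \<in> S \<Longrightarrow> \<bar>f x\<bar> \<le> C * norm x"
  obtains w where "w \<in> S" "\<And>y. y \<in> S \<Longrightarrow> f y = w \<bullet> y"
proof -
  define K where "K = (\<lambda>x. (x, - 2 * f x)) ` S"
  have K1: "convex K"
    unfolding K_def
  proof (rule convexI, clarify)
    fix x y :: 'a and u v :: real
    assume *: "x \<in> S" "y \<in> S" "0 \<le> u" "0 \<le> v" "u + v = 1"
    then have "u *\<^sub>R x + v *\<^sub>R y \<in> S" using S(1) by (simp add: subspace_add subspace_scale)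
    moreover have "f (u *\<^sub>R x + v *\<^sub>R y) = u * f x + v * f y"
      using * S(1) by (simp add: add scale subspace_scale)
    ultimately show "u *\<^sub>R (x, - 2 * f x) + v *\<^sub>R (y, - 2 * f y) \<in> (\<lambda>x. (x, - 2 * f x)) ` S"
      by (auto simp: image_iff algebra_simps)
  qed
  have K2: "K \<noteq> {}" using subspace_0[OF S(1)] by (auto simp: K_def)
  have K3: "- C\<^sup>2 \<le> (norm p)\<^sup>2 + c" if "(p, c) \<in> K" for p c
  proof -
    have p: "p \<in> S" "c = - 2 * f p" using that by (auto simp: K_def)
    have "f p \<le> C * norm p" using bound[OF p(1)] by linarith
    moreover have "0 \<le> (norm p - C)\<^sup>2" by simp
    ultimately show ?thesis using p(2) by (simp add: power2_eq_square algebra_simps)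
  qed
  obtain w where w: "w \<in> closure (fst ` K)"
    "\<And>q c. (q, c) \<in> K \<Longrightarrow> (norm w)\<^sup>2 + - C\<^sup>2 \<le> 2 * (w \<bullet> q) + c"
    using convex_minimizing_limit[OF K1 K2 K3] by blast
  have "fst ` K = S" by (force simp: K_def)
  then have "w \<in> S" using w(1) S(2) by simp
  moreover have "f y = w \<bullet> y" if y: "y \<in> S" for y
  proof (rule ccontr)
    \<comment> \<open>A linear functional that is bounded below vanishes: otherwise a large multiple violates the bound.\<close>
    define g where "g = 2 * (w \<bullet> y) - 2 * f y"
    assume "f y \<noteq> w \<bullet> y"
    then have "g \<noteq> 0" by (simp add: g_def)
    define t where "t = ((norm w)\<^sup>2 - C\<^sup>2 - 1) / g"
    have "t *\<^sub>R y \<in> S" using y S(1) by (simp add: subspace_scale)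
    then have "(t *\<^sub>R y, - 2 * f (t *\<^sub>R y)) \<in> K" by (auto simp: K_def)
    from w(2)[OF this] have "(norm w)\<^sup>2 - C\<^sup>2 \<le> t * g"
      using y by (simp add: scale g_def algebra_simps)
    also have "t * g = (norm w)\<^sup>2 - C\<^sup>2 - 1" using \<open>g \<noteq> 0\<close> by (simp add: t_def)
    finally show False by simp
  qed
  ultimately show ?thesis using that by blast
qed

text \<open>The constant \<open>adjoint\<close> is a Hilbert choice; its defining property holds as soon as some adjoint exists,
which the Riesz representation provides in every Hilbert space.\<close>

lemma inner_adjoint:
  fixes L :: "'a::{real_inner,banach} \<Rightarrow> 'b::real_inner"
  assumes L: "bounded_linear L"
  shows "x \<bullet> adjoint L y = L x \<bullet> y"
proof -
  interpret bounded_linear L by (fact L)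
  have "\<exists>w. \<forall>x. L x \<bullet> y = x \<bullet> w" for y
  proof -
    obtain C where C: "\<And>x. norm (L x) \<le> norm x * C" using bounded by blast
    have "\<bar>L x \<bullet> y\<bar> \<le> (C * norm y) * norm x" for x
    proof -
      have "\<bar>L x \<bullet> y\<bar> \<le> norm (L x) * norm y" by (rule Cauchy_Schwarz_ineq2)
      also have "\<dots> \<le> (norm x * C) * norm y" by (intro mult_right_mono C) auto
      finally show ?thesis by (simp add: mult_ac)
    qed
    then obtain w where "\<And>x. L x \<bullet> y = w \<bullet> x"
      using riesz_representation_on[of UNIV "\<lambda>x. L x \<bullet> y" "C * norm y"]
      by (auto simp: add scaleR inner_left_distrib)
    then show ?thesis by (auto simp: inner_commute)
  qed
  then have "\<exists>f'. \<forall>x y. L x \<bullet> y = x \<bullet> f' y" by metis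
  then have "\<forall>x y. L x \<bullet> y = x \<bullet> adjoint L y" unfolding adjoint_def by (rule someI_ex)
  then show ?thesis by simp
qed

lemma bounded_linear_adjoint:
  fixes L :: "'a::{real_inner,banach} \<Rightarrow> 'b::real_inner"
  assumes L: "bounded_linear L"
  shows "bounded_linear (adjoint L)"
proof (rule bounded_linear_intro[where K = "onorm L"])
  note ia = inner_adjoint[OF L]
  show "adjoint L (x + y) = adjoint L x + adjoint L y" for x y
    by (rule vector_eq_ldot[THEN iffD1]) (simp add: ia inner_right_distrib)
  show "adjoint L (c *\<^sub>R x) = c *\<^sub>R adjoint L x" for c x
    by (rule vector_eq_ldot[THEN iffD1]) (simp add: ia)
  fix y
  have "(norm (adjoint L y))\<^sup>2 = L (adjoint L y) \<bullet> y" by (simp add: power2_norm_eq_inner ia)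
  also have "\<dots> \<le> norm (L (adjoint L y)) * norm y" by (rule norm_cauchy_schwarz)
  also have "\<dots> \<le> onorm L * norm (adjoint L y) * norm y"
    by (intro mult_right_mono onorm[OF L]) auto
  finally have "norm (adjoint L y) * norm (adjoint L y) \<le> norm (adjoint L y) * (norm y * onorm L)"
    by (simp add: power2_eq_square mult_ac)
  then show "norm (adjoint L y) \<le> norm y * onorm L"
    using onorm_pos_le[OF L] by (cases "adjoint L y = 0") auto
qed

lemma maximally_monotone_onD:
  assumes "maximally_monotone_on S A"
  shows "u \<in> A x \<Longrightarrow> x \<in> S" "u \<in> A x \<Longrightarrow> u \<in> S"
    and "u \<in> A x \<Longrightarrow> v \<in> A y \<Longrightarrow> 0 \<le> (x - y) \<bullet> (u - v)"
  using assms by (force simp: maximally_monotone_on_def monotone_op_def Gr_def)+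

text \<open>Maximality in its usable form: a pair monotonically related to the graph belongs to it, since
adjoining it would give a monotone extension.\<close>

lemma maximally_monotone_on_mem:
  assumes A: "maximally_monotone_on S A" and S: "x \<in> S" "u \<in> S"
    and rel: "\<And>y v. v \<in> A y \<Longrightarrow> 0 \<le> (x - y) \<bullet> (u - v)"
  shows "u \<in> A x"
proof -
  define A' where "A' = (\<lambda>y. if y = x then insert u (A y) else A y)"
  have "Gr A' = insert (x, u) (Gr A)" by (auto simp: A'_def Gr_def split: if_splits)
  moreover have "monotone_op A'"
    unfolding monotone_op_def \<open>Gr A' = _\<close>
  proof clarify
    fix y v y' v'
    assume "(y, v) \<in> insert (x, u) (Gr A)" "(y', v') \<in> insert (x, u) (Gr A)"
    moreover have "0 \<le> (y - x) \<bullet> (v - u)" if "v \<in> A y" for y v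
      using rel[OF that] by (simp add: inner_simps algebra_simps)
    ultimately show "0 \<le> (y - y') \<bullet> (v - v')"
      using rel maximally_monotone_onD(3)[OF A] by (auto simp: Gr_def)
  qed
  moreover have "Gr A \<subseteq> S \<times> S" using A by (simp add: maximally_monotone_on_def)
  ultimately have "Gr A' = Gr A"
    using A S unfolding maximally_monotone_on_def by (metis insert_subset mem_Sigma_iff subset_insertI)
  with \<open>Gr A' = insert (x, u) (Gr A)\<close> show ?thesis by (auto simp: Gr_def)
qed

lemma maximally_monotone_onI:
  assumes "\<And>x u. u \<in> A x \<Longrightarrow> x \<in> S \<and> u \<in> S"
    and "\<And>x u y v. u \<in> A x \<Longrightarrow> v \<in> A y \<Longrightarrow> 0 \<le> (x - y) \<bullet> (u - v)"
    and "\<And>x u. x \<in> S \<Longrightarrow> u \<in> S \<Longrightarrow> (\<And>y v. v \<in> A y \<Longrightarrow> 0 \<le> (x - y) \<bullet> (u - v)) \<Longrightarrow> u \<in> A x"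
  shows "maximally_monotone_on S A"
  unfolding maximally_monotone_on_def
proof (intro conjI allI impI)
  show "Gr A \<subseteq> S \<times> S" "monotone_op A"
    using assms(1,2) by (auto simp: Gr_def monotone_op_def)
  fix A' assume A': "Gr A' \<subseteq> S \<times> S \<and> monotone_op A' \<and> Gr A \<subseteq> Gr A'"
  have "u \<in> A x" if "(x, u) \<in> Gr A'" for x u
    using A' that by (intro assms(3)) (auto simp: monotone_op_def Gr_def subset_iff)
  with A' show "Gr A' = Gr A" by (auto simp: Gr_def)
qed

lemma mem_inverse_op [simp]: "x \<in> inverse_op A u \<longleftrightarrow> u \<in> A x"
  by (simp add: inverse_op_def Gr_def)

lemma maximally_monotone_inverse_op:
  assumes "maximally_monotone_on S A"
  shows "maximally_monotone_on S (inverse_op A)"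
proof (rule maximally_monotone_onI)
  note mono = maximally_monotone_onD[OF assms]
  show "x \<in> S \<and> u \<in> S" if "u \<in> inverse_op A x" for x u using that mono by auto
  show "0 \<le> (x - y) \<bullet> (u - v)" if "u \<in> inverse_op A x" "v \<in> inverse_op A y" for x u y v
    using mono(3)[of x u v] mono(3)[of x u y v] that by (simp add: inner_commute)
  show "u \<in> inverse_op A x"
    if "x \<in> S" "u \<in> S" "\<And>y v. v \<in> inverse_op A y \<Longrightarrow> 0 \<le> (x - y) \<bullet> (u - v)" for x u
    using that by (auto intro!: maximally_monotone_on_mem[OF assms] simp: inner_commute)
qed

lemma mem_scale_op: "c \<noteq> 0 \<Longrightarrow> u \<in> scale_op c A x \<longleftrightarrow> (1 / c) *\<^sub>R u \<in> A x"
  by (force simp: scale_op_def)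

lemma maximally_monotone_scale_op:
  assumes A: "maximally_monotone_on S A" and c: "c > 0" and S: "subspace S"
  shows "maximally_monotone_on S (scale_op c A)"
proof (rule maximally_monotone_onI)
  note mono = maximally_monotone_onD[OF A]
  show "x \<in> S \<and> u \<in> S" if "u \<in> scale_op c A x" for x u
    using that mono(1,2) S by (auto simp: scale_op_def subspace_scale)
  show "0 \<le> (x - y) \<bullet> (u - v)" if "u \<in> scale_op c A x" "v \<in> scale_op c A y" for x u y v
  proof -
    from that obtain u' v' where "u' \<in> A x" "v' \<in> A y" "u = c *\<^sub>R u'" "v = c *\<^sub>R v'"
      by (auto simp: scale_op_def)
    then show ?thesis using mono(3)[of u' x v' y] c by (simp flip: scaleR_diff_right)
  qed
  show "u \<in> scale_op c A x"
    if "x \<in> S" "u \<in> S" and rel: "\<And>y v. v \<in> scale_op c A y \<Longrightarrow> 0 \<le> (x - y) \<bullet> (u - v)" for x u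
  proof -
    have "0 \<le> (x - y) \<bullet> ((1 / c) *\<^sub>R u - v)" if "v \<in> A y" for y v
    proof -
      have "0 \<le> (x - y) \<bullet> (u - c *\<^sub>R v)" using that by (intro rel) (auto simp: scale_op_def)
      also have "u - c *\<^sub>R v = c *\<^sub>R ((1 / c) *\<^sub>R u - v)" using c by (simp add: algebra_simps)
      finally show ?thesis using c by (simp add: zero_le_mult_iff)
    qed
    then show ?thesis
      using that S c by (auto simp: mem_scale_op subspace_scale intro!: maximally_monotone_on_mem[OF A])
  qed
qed

text \<open>Minty's theorem. After shifting by \<open>y\<close>, the point \<open>p\<close> must satisfy \<open>\<langle>p - x, - p - u\<rangle> \<ge> 0\<close>, that is
\<open>\<parallel>p\<parallel>\<^sup>2 \<le> 2 \<langle>p, (x - u)/2\<rangle> + \<langle>x, u\<rangle>\<close>, for all \<open>(x, u)\<close> in the graph. This is the optimality condition of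
\<open>convex_minimizing_limit\<close> for the convex hull of the pairs \<open>((x - u)/2, \<langle>x, u\<rangle>)\<close>, provided
\<open>\<parallel>p\<parallel>\<^sup>2 + c\<close> is nonnegative on that hull. The latter is where monotonicity enters: it implies
\<open>\<langle>x, u\<rangle> \<le> c\<close> for all convex combinations \<open>(x, u, c)\<close> of triples \<open>(x, u, \<langle>x, u\<rangle>)\<close>.\<close>

lemma minty:
  fixes A :: "'a::{real_inner,banach} \<Rightarrow> 'a set"
  assumes A: "maximally_monotone_on S A" and S: "subspace S" "closed S" and y: "y \<in> S"
  obtains p where "p \<in> S" "y - p \<in> A p"
proof -
  note mono = maximally_monotone_onD[OF A]
  define T where "T = {(x, u - y, x \<bullet> (u - y)) | x u. u \<in> A x}"
  have T_rel: "0 \<le> c + d - x \<bullet> v - x' \<bullet> u" if "(x, u, c) \<in> T" "(x', v, d) \<in> T" for x u c x' v d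
    using mono(3) that by (fastforce simp: T_def inner_simps algebra_simps inner_commute)
  \<comment> \<open>The relation \<open>T_rel\<close> is affine in each triple separately, so it extends from \<open>T\<close> to its hull in
    one argument and then in the other; on the diagonal it reads \<open>0 \<le> 2 * c - 2 * (x \<bullet> u)\<close>.\<close>
  define half where "half x' v d = {k :: 'a \<times> 'a \<times> real. 0 \<le> snd (snd k) + d - fst k \<bullet> v - x' \<bullet> fst (snd k)}"
    for x' v d
  have half_convex: "convex (half x' v d)" for x' v d
  proof -
    have "linear (\<lambda>k::'a \<times> 'a \<times> real. snd (snd k) - fst k \<bullet> v - x' \<bullet> fst (snd k))"
      by (rule linearI) (auto simp: inner_simps algebra_simps)
    moreover have "half x' v d = (\<lambda>k. snd (snd k) - fst k \<bullet> v - x' \<bullet> fst (snd k)) -` {- d..}"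
      by (auto simp: half_def)
    ultimately show ?thesis by (auto intro!: convex_linear_vimage convex_real_interval)
  qed
  have step: "(x, u, c) \<in> half x' v d" if "(x, u, c) \<in> convex hull T" "(x', v, d) \<in> T" for x u c x' v d
  proof -
    have "convex hull T \<subseteq> half x' v d"
      by (rule hull_minimal) (use T_rel that(2) half_convex in \<open>auto simp: half_def\<close>)
    then show ?thesis using that(1) by blast
  qed
  have hull_rel: "x \<bullet> u \<le> c" if k: "(x, u, c) \<in> convex hull T" for x u c
  proof -
    have "convex hull T \<subseteq> half x u c"
    proof (rule hull_minimal)
      show "T \<subseteq> half x u c"
      proof clarify
        fix x' v d assume "(x', v, d) \<in> T"
        from step[OF k this] show "(x', v, d) \<in> half x u c" by (simp add: half_def algebra_simps inner_commute)
      qed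
    qed (rule half_convex)
    with k show ?thesis by (auto simp: half_def)
  qed
  define K where "K = (\<lambda>(x, u, c). ((1/2) *\<^sub>R (x - u), c)) ` (convex hull T)"
  have lin: "linear (\<lambda>(x, u, c). ((1/2) *\<^sub>R (x - u), c) :: 'a \<times> real)"
    by (rule linearI) (auto simp: algebra_simps split: prod.splits)
  have K1: "convex K" unfolding K_def by (intro convex_linear_image lin convex_convex_hull)
  have K2: "K \<noteq> {}"
  proof -
    \<comment> \<open>The empty graph is not maximal: it extends to \<open>{(0, 0)}\<close>.\<close>
    have "\<exists>x u. u \<in> A x"
    proof (rule ccontr)
      assume none: "\<nexists>x u. u \<in> A x"
      have "0 \<in> A 0"
        by (rule maximally_monotone_on_mem[OF A]) (use none subspace_0[OF S(1)] in auto)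
      with none show False by blast
    qed
    then show ?thesis by (auto simp: K_def T_def)
  qed
  have K3: "0 \<le> (norm p)\<^sup>2 + c" if "(p, c) \<in> K" for p c
  proof -
    from that obtain x u where xu: "(x, u, c) \<in> convex hull T" "p = (1/2) *\<^sub>R (x - u)"
      by (auto simp: K_def)
    have "(norm p)\<^sup>2 + x \<bullet> u = (norm ((1/2) *\<^sub>R (x + u)))\<^sup>2"
      unfolding xu(2) power2_norm_eq_inner by (simp add: inner_simps inner_commute field_simps)
    with hull_rel[OF xu(1)] show ?thesis by (smt (verit) zero_le_power2)
  qed
  obtain p where p: "p \<in> closure (fst ` K)"
    "\<And>q c. (q, c) \<in> K \<Longrightarrow> (norm p)\<^sup>2 + 0 \<le> 2 * (p \<bullet> q) + c"
    using convex_minimizing_limit[OF K1 K2 K3] by blast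
  have "fst ` K \<subseteq> S"
  proof -
    have "convex hull T \<subseteq> S \<times> S \<times> UNIV"
      using mono(1,2) S(1) y
      by (intro hull_minimal convex_Times subspace_imp_convex) (auto simp: T_def subspace_diff)
    then show ?thesis using S(1) by (auto simp: K_def subspace_diff subspace_scale)
  qed
  then have "p \<in> S" using p(1) S(2) closure_minimal by blast
  moreover have "y - p \<in> A p"
  proof (rule maximally_monotone_on_mem[OF A])
    fix x u assume "u \<in> A x"
    then have "(x, u - y, x \<bullet> (u - y)) \<in> convex hull T" by (intro hull_inc) (auto simp: T_def)
    then have "((1/2) *\<^sub>R (x - (u - y)), x \<bullet> (u - y)) \<in> K" by (force simp: K_def)
    from p(2)[OF this] show "0 \<le> (p - x) \<bullet> (y - p - u)"
      by (simp add: power2_norm_eq_inner inner_simps inner_commute algebra_simps)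
  qed (use \<open>p \<in> S\<close> y S(1) in \<open>auto simp: subspace_diff\<close>)
  ultimately show ?thesis using that by blast
qed

lemma resolvent_eqI:
  assumes mono: "monotone_op A" and p: "y - p \<in> A p"
  shows "resolvent A y = p"
  unfolding resolvent_def
proof (rule the_equality)
  show "p \<in> inverse_op (\<lambda>y. {y} + A y) y"
    using p by (auto simp: set_plus_def intro!: bexI[of _ "y - p"])
  fix q assume "q \<in> inverse_op (\<lambda>y. {y} + A y) y"
  then have "y - q \<in> A q" by (auto simp: set_plus_def algebra_simps)
  then have "0 \<le> (q - p) \<bullet> (y - q - (y - p))"
    using mono p by (fastforce simp: monotone_op_def Gr_def)
  also have "\<dots> = - ((q - p) \<bullet> (q - p))" by (simp add: inner_simps algebra_simps)
  finally have "(q - p) \<bullet> (q - p) \<le> 0" by simp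
  then show "q = p" by (simp add: inner_gt_zero_iff flip: not_less)
qed

lemma resolvent_mem:
  fixes A :: "'a::{real_inner,banach} \<Rightarrow> 'a set"
  assumes A: "maximally_monotone_on S A" and S: "subspace S" "closed S" and y: "y \<in> S"
  shows "resolvent A y \<in> S" "y - resolvent A y \<in> A (resolvent A y)"
proof -
  obtain p where "p \<in> S" "y - p \<in> A p" using minty[OF A S y] .
  moreover from this have "resolvent A y = p"
    using A by (intro resolvent_eqI) (auto simp: maximally_monotone_on_def)
  ultimately show "resolvent A y \<in> S" "y - resolvent A y \<in> A (resolvent A y)" by auto
qed

lemma resolvent_scale_mem:
  fixes A :: "'a::{real_inner,banach} \<Rightarrow> 'a set"
  assumes A: "maximally_monotone_on S A" and S: "subspace S" "closed S" and "c > 0" "y \<in> S"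
  shows "resolvent (scale_op c A) y \<in> S"
    "(1 / c) *\<^sub>R (y - resolvent (scale_op c A) y) \<in> A (resolvent (scale_op c A) y)"
  using resolvent_mem[OF maximally_monotone_scale_op[OF A \<open>c > 0\<close> S(1)] S \<open>y \<in> S\<close>] \<open>c > 0\<close>
  by (auto simp: mem_scale_op)

lemma resolvent_scale_eqI:
  fixes A :: "'a::{real_inner,banach} \<Rightarrow> 'a set"
  assumes A: "maximally_monotone_on S A" and S: "subspace S" and c: "c > 0"
    and "(1 / c) *\<^sub>R (y - p) \<in> A p"
  shows "resolvent (scale_op c A) y = p"
  using assms maximally_monotone_scale_op[OF A c S]
  by (intro resolvent_eqI) (auto simp: mem_scale_op maximally_monotone_on_def)

section \<open>Weak compactness and inertial Lyapunov sequences\<close>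

text \<open>The analogue for filters of the fact that a sequence converges if each of its subsequences has a further
subsequence with the given limit.\<close>

lemma tendsto_if_subfilters_tendsto:
  assumes "\<And>F'. F' \<le> F \<Longrightarrow> F' \<noteq> bot \<Longrightarrow> \<exists>F''. F'' \<le> F' \<and> F'' \<noteq> bot \<and> (f \<longlongrightarrow> l) F''"
  shows "(f \<longlongrightarrow> l) F"
proof (rule topological_tendstoI, rule ccontr)
  fix U assume U: "open U" "l \<in> U" and not: "\<not> (\<forall>\<^sub>F x in F. f x \<in> U)"
  define F' where "F' = inf F (principal {x. f x \<notin> U})"
  have "F' \<noteq> bot"
    using not unfolding F'_def trivial_limit_def eventually_inf_principal by simp
  then obtain F'' where F'': "F'' \<le> F'" "F'' \<noteq> bot" "(f \<longlongrightarrow> l) F''"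
    using assms[of F'] by (auto simp: F'_def)
  have "\<forall>\<^sub>F x in F'. f x \<notin> U"
    by (auto simp: F'_def eventually_inf_principal)
  with F''(1) have "\<forall>\<^sub>F x in F''. f x \<notin> U" by (rule filter_leD)
  moreover have "\<forall>\<^sub>F x in F''. f x \<in> U" using topological_tendstoD[OF F''(3) U] .
  ultimately have "\<forall>\<^sub>F x in F''. False" by eventually_elim simp
  with F''(2) show False by simp
qed

text \<open>The functionals \<open>y \<mapsto> \<langle>X n, y\<rangle>\<close> lie in a product of compact intervals, so by Tychonoff's theorem they cluster
at some function, which is linear and bounded as a pointwise limit and therefore given by a vector of \<open>S\<close>.
Passing to a finer filter takes the place of extracting a subsequence and works in nonseparable spaces
without change.\<close>

lemma bounded_weak_cluster_point:
  fixes X :: "'i \<Rightarrow> 'a::{real_inner,banach}"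
  assumes S: "subspace S" "closed S" and F: "F \<noteq> bot"
    and bound: "\<And>n. norm (X n) \<le> M"
  shows "\<exists>F' w. F' \<le> F \<and> F' \<noteq> bot \<and> w \<in> S \<and> (\<forall>y\<in>S. ((\<lambda>n. X n \<bullet> y) \<longlongrightarrow> w \<bullet> y) F')"
proof -
  define \<Phi> where "\<Phi> = (\<lambda>n y. X n \<bullet> y)"
  define box where "box = (PiE UNIV (\<lambda>y. {- (M * norm y)..M * norm y}) :: ('a \<Rightarrow> real) set)"
  have abs_le: "\<bar>X n \<bullet> y\<bar> \<le> M * norm y" for n y
  proof -
    have "\<bar>X n \<bullet> y\<bar> \<le> norm (X n) * norm y" by (rule Cauchy_Schwarz_ineq2)
    also have "\<dots> \<le> M * norm y" by (intro mult_right_mono bound) auto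
    finally show ?thesis .
  qed
  have "compactin (product_topology (\<lambda>_. euclidean) UNIV) box"
    unfolding box_def by (subst compactin_PiE) auto
  then have "compact box" by (simp add: euclidean_product_topology)
  moreover have "filtermap \<Phi> F \<noteq> bot" using F by (simp add: filtermap_bot_iff)
  moreover have "\<forall>\<^sub>F g in filtermap \<Phi> F. g \<in> box"
    using abs_le
    by (auto simp: eventually_filtermap box_def \<Phi>_def abs_le_iff minus_le_iff intro!: always_eventually)
  ultimately obtain f where f: "inf (nhds f) (filtermap \<Phi> F) \<noteq> bot"
    unfolding compact_filter by blast
  define F' where "F' = inf F (filtercomap \<Phi> (nhds f))"
  have F': "F' \<le> F" by (simp add: F'_def)
  have "F' \<noteq> bot"
  proof
    assume "F' = bot"
    then obtain Q R where QR: "eventually Q F" "eventually R (nhds f)" "\<And>n. Q n \<Longrightarrow> R (\<Phi> n) \<Longrightarrow> False"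
      unfolding trivial_limit_def F'_def eventually_inf eventually_filtercomap by blast
    have "\<forall>\<^sub>F g in filtermap \<Phi> F. \<not> R g"
      using QR(1) unfolding eventually_filtermap by eventually_elim (use QR(3) in blast)
    with QR(2) have "\<forall>\<^sub>F g in inf (nhds f) (filtermap \<Phi> F). False"
      unfolding eventually_inf by blast
    with f show False by simp
  qed
  have lim: "((\<lambda>n. X n \<bullet> y) \<longlongrightarrow> f y) F'" for y
  proof -
    have \<Phi>: "filterlim \<Phi> (nhds f) F'"
      by (rule filterlim_mono[OF filterlim_filtercomap order_refl]) (simp add: F'_def)
    show ?thesis
    proof (rule topological_tendstoI)
      fix U assume "open U" "f y \<in> U"
      have "open ((\<lambda>g::'a \<Rightarrow> real. g y) -` U)"
        by (rule open_vimage[OF \<open>open U\<close> continuous_on_product_coordinates])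
      from eventually_nhds_in_open[OF this, of f] have "\<forall>\<^sub>F g in nhds f. g y \<in> U"
        using \<open>f y \<in> U\<close> by simp
      from eventually_compose_filterlim[OF this \<Phi>] show "\<forall>\<^sub>F n in F'. X n \<bullet> y \<in> U"
        by (simp add: \<Phi>_def)
    qed
  qed
  note unique = tendsto_unique[OF \<open>F' \<noteq> bot\<close>]
  obtain w where w: "w \<in> S" "\<And>y. y \<in> S \<Longrightarrow> f y = w \<bullet> y"
  proof (rule riesz_representation_on[OF S, of f M])
    show "f (x + y) = f x + f y" for x y
      by (rule unique[OF lim]) (use tendsto_add[OF lim lim] in \<open>simp add: inner_right_distrib\<close>)
    show "f (c *\<^sub>R x) = c * f x" for c x
      by (rule unique[OF lim]) (use tendsto_mult_left[OF lim] in \<open>simp\<close>)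
    show "\<bar>f y\<bar> \<le> M * norm y" for y
      by (rule tendsto_upperbound[OF tendsto_rabs[OF lim] _ \<open>F' \<noteq> bot\<close>]) (simp add: abs_le)
  qed (use that in blast)
  have "((\<lambda>n. X n \<bullet> y) \<longlongrightarrow> w \<bullet> y) F'" if "y \<in> S" for y
    using lim[of y] w(2)[OF that] by simp
  with F' \<open>F' \<noteq> bot\<close> w(1) show ?thesis by blast
qed

text \<open>The quantity \<open>\<mu> n = \<phi> (n + 1) - a n * \<phi> n + \<gamma> * D n\<close> decreases by at least \<open>\<sigma> * D (n + 1)\<close> because the
inertial parameters are nondecreasing. Since \<open>\<alpha> < 1\<close>, the bound \<open>\<phi> (n + 1) \<le> \<alpha> * \<phi> n + \<mu> 0\<close> keeps \<open>\<phi>\<close>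
bounded, hence \<open>\<mu>\<close> bounded below and \<open>D\<close> summable. For the convergence of \<open>\<phi>\<close>, the positive parts of its
increments satisfy a contractive recursion with summable perturbation, so \<open>\<phi>\<close> is a decreasing sequence
plus a convergent series.\<close>

lemma inertial_descent:
  fixes \<phi> D a :: "nat \<Rightarrow> real"
  assumes \<phi>: "\<And>n. 0 \<le> \<phi> n" and D: "\<And>n. 0 \<le> D n"
    and a: "\<And>n. 0 \<le> a n" "\<And>n. a n \<le> \<alpha>" "\<And>n. a n \<le> a (Suc n)" and \<alpha>: "\<alpha> < 1"
    and \<gamma>: "0 \<le> \<gamma>" and \<sigma>: "0 < \<sigma>"
    and descent: "\<And>n. \<phi> (Suc (Suc n)) \<le>
      \<phi> (Suc n) + a n * (\<phi> (Suc n) - \<phi> n) + \<gamma> * D n - (\<gamma> + \<sigma>) * D (Suc n)"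
  shows "summable D" "convergent \<phi>"
proof -
  have \<alpha>0: "0 \<le> \<alpha>" using a(1)[of 0] a(2)[of 0] by linarith
  define \<mu> where "\<mu> = (\<lambda>n. \<phi> (Suc n) - a n * \<phi> n + \<gamma> * D n)"
  have \<mu>_step: "\<mu> (Suc n) \<le> \<mu> n - \<sigma> * D (Suc n)" for n
  proof -
    have "a n * \<phi> (Suc n) \<le> a (Suc n) * \<phi> (Suc n)" by (intro mult_right_mono a \<phi>)
    with descent[of n] show ?thesis by (simp add: \<mu>_def algebra_simps)
  qed
  have \<mu>_sum: "\<mu> n \<le> \<mu> 0 - \<sigma> * (\<Sum>k<n. D (Suc k))" for n
  proof (induction n)
    case (Suc n)
    then show ?case using \<mu>_step[of n] by (simp add: algebra_simps)
  qed simp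
  have \<mu>_le: "\<mu> n \<le> \<mu> 0" for n
    using \<mu>_sum[of n] \<sigma> D by (smt (verit) mult_nonneg_nonneg sum_nonneg)
  have \<phi>_rec: "\<phi> (Suc n) \<le> \<alpha> * \<phi> n + \<mu> 0" for n
  proof -
    have "a n * \<phi> n \<le> \<alpha> * \<phi> n" by (intro mult_right_mono a \<phi>)
    then show ?thesis
      using \<mu>_le[of n] mult_nonneg_nonneg[OF \<gamma> D[of n]] unfolding \<mu>_def by linarith
  qed
  define C where "C = \<phi> 0 + \<bar>\<mu> 0\<bar> / (1 - \<alpha>)"
  have C: "\<alpha> * C + \<bar>\<mu> 0\<bar> \<le> C"
  proof -
    have "\<alpha> * (\<bar>\<mu> 0\<bar> / (1 - \<alpha>)) + \<bar>\<mu> 0\<bar> = \<bar>\<mu> 0\<bar> / (1 - \<alpha>)"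
      using \<alpha> by (simp add: field_simps)
    moreover have "\<alpha> * \<phi> 0 \<le> 1 * \<phi> 0" using \<alpha> by (intro mult_right_mono \<phi>) simp
    ultimately show ?thesis unfolding C_def by (simp add: distrib_left)
  qed
  have \<phi>_le: "\<phi> n \<le> C" for n
  proof (induction n)
    case 0
    then show ?case using \<alpha> by (simp add: C_def)
  next
    case (Suc n)
    then have "\<alpha> * \<phi> n \<le> \<alpha> * C" using \<alpha>0 by (rule mult_left_mono)
    then show ?case using \<phi>_rec[of n] C by linarith
  qed
  have "(\<Sum>k<n. D (Suc k)) \<le> (\<mu> 0 + \<alpha> * C) / \<sigma>" for n
  proof -
    have "a n * \<phi> n \<le> \<alpha> * C" by (intro mult_mono a \<phi>_le \<phi> \<alpha>0)
    then have "- (\<alpha> * C) \<le> \<mu> n"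
      using \<phi>[of "Suc n"] mult_nonneg_nonneg[OF \<gamma> D[of n]] unfolding \<mu>_def by linarith
    with \<mu>_sum[of n] \<sigma> show ?thesis by (simp add: field_simps)
  qed
  then have "summable (\<lambda>k. D (Suc k))"
    by (intro summableI_nonneg_bounded D)
  then show sumD: "summable D" by (simp add: summable_Suc_iff)
  define \<theta> where "\<theta> = (\<lambda>n. max 0 (\<phi> (Suc n) - \<phi> n))"
  have \<theta>_rec: "\<theta> (Suc n) \<le> \<alpha> * \<theta> n + \<gamma> * D n" for n
  proof -
    have "a n * (\<phi> (Suc n) - \<phi> n) \<le> a n * \<theta> n"
      by (intro mult_left_mono a) (simp add: \<theta>_def)
    also have "\<dots> \<le> \<alpha> * \<theta> n" by (intro mult_right_mono a) (simp add: \<theta>_def)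
    finally have "\<phi> (Suc (Suc n)) - \<phi> (Suc n) \<le> \<alpha> * \<theta> n + \<gamma> * D n"
      using descent[of n] mult_nonneg_nonneg[of "\<gamma> + \<sigma>" "D (Suc n)"] \<gamma> \<sigma> D by fastforce
    moreover have "0 \<le> \<alpha> * \<theta> n + \<gamma> * D n" using \<alpha>0 \<gamma> D by (simp add: \<theta>_def)
    ultimately show ?thesis by (simp add: \<theta>_def)
  qed
  have "summable \<theta>"
  proof (rule summableI_nonneg_bounded)
    show "0 \<le> \<theta> n" for n by (simp add: \<theta>_def)
    fix n
    have "(\<Sum>k<n. \<theta> k) \<le> (\<Sum>k<Suc n. \<theta> k)" by (simp add: \<theta>_def)
    also have "\<dots> = \<theta> 0 + (\<Sum>k<n. \<theta> (Suc k))" by (rule sum.lessThan_Suc_shift)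
    also have "\<dots> \<le> \<theta> 0 + (\<Sum>k<n. \<alpha> * \<theta> k + \<gamma> * D k)" by (intro add_left_mono sum_mono \<theta>_rec)
    also have "\<dots> = \<theta> 0 + \<alpha> * (\<Sum>k<n. \<theta> k) + \<gamma> * (\<Sum>k<n. D k)"
      by (simp add: sum.distrib sum_distrib_left)
    also have "\<dots> \<le> \<theta> 0 + \<alpha> * (\<Sum>k<n. \<theta> k) + \<gamma> * suminf D"
      by (intro add_left_mono mult_left_mono sum_le_suminf sumD \<gamma>) (auto simp: D)
    finally show "(\<Sum>k<n. \<theta> k) \<le> (\<theta> 0 + \<gamma> * suminf D) / (1 - \<alpha>)"
      using \<alpha> by (simp add: field_simps)
  qed
  define \<psi> where "\<psi> = (\<lambda>n. \<phi> n - (\<Sum>k<n. \<theta> k))"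
  have "decseq \<psi>"
    by (rule decseq_SucI) (simp add: \<psi>_def \<theta>_def)
  have "\<bar>\<psi> n\<bar> \<le> C + suminf \<theta>" for n
  proof -
    have "(\<Sum>k<n. \<theta> k) \<le> suminf \<theta>"
      by (intro sum_le_suminf \<open>summable \<theta>\<close>) (auto simp: \<theta>_def)
    moreover have "0 \<le> (\<Sum>k<n. \<theta> k)" by (intro sum_nonneg) (simp add: \<theta>_def)
    ultimately show ?thesis using \<phi>[of n] \<phi>_le[of n] unfolding \<psi>_def by linarith
  qed
  then have "Bseq \<psi>" by (intro BseqI'[of _ "C + suminf \<theta>"]) simp
  then have "convergent \<psi>"
    using decseq_imp_monoseq[OF \<open>decseq \<psi>\<close>] by (rule Bseq_monoseq_convergent)
  then have "convergent (\<lambda>n. \<psi> n + (\<Sum>k<n. \<theta> k))"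
    using \<open>summable \<theta>\<close> by (intro convergent_add) (simp_all flip: summable_iff_convergent)
  then show "convergent \<phi>" by (simp add: \<psi>_def)
qed

text \<open>The upper bound on the relaxation parameter is equivalent to the second conclusion for \<open>a = \<alpha>\<close>; smaller
\<open>a\<close> only increases the right-hand side.\<close>

lemma relaxation_coefficient:
  fixes \<alpha> \<delta> \<sigma> \<kappa> a :: real
  defines "\<gamma> \<equiv> \<alpha> * (1 + \<alpha>) + \<alpha> * \<delta>"
  assumes "0 \<le> a" "a \<le> \<alpha>" "0 < \<delta>" "0 < \<sigma>" "0 < \<kappa>"
    and \<kappa>: "\<kappa> \<le> (\<delta> - \<alpha> * (\<gamma> + \<sigma>)) / (\<delta> * (1 + (\<gamma> + \<sigma>)))"
  shows "\<kappa> < 1" "\<gamma> + \<sigma> \<le> (1 - \<kappa>) * \<delta> / (a + \<delta> * \<kappa>)"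
proof -
  have \<gamma>: "0 \<le> \<gamma>" using assms by (simp add: \<gamma>_def)
  have "\<kappa> * (\<delta> * (1 + (\<gamma> + \<sigma>))) \<le> \<delta> - \<alpha> * (\<gamma> + \<sigma>)"
  proof -
    have "0 < \<delta> * (1 + (\<gamma> + \<sigma>))"
      using \<gamma> \<open>0 < \<delta>\<close> \<open>0 < \<sigma>\<close> by (intro mult_pos_pos) linarith+
    with \<kappa> show ?thesis by (simp add: pos_le_divide_eq)
  qed
  then have *: "(\<alpha> + \<delta> * \<kappa>) * (\<gamma> + \<sigma>) \<le> (1 - \<kappa>) * \<delta>" by (simp add: algebra_simps)
  have "0 < (\<alpha> + \<delta> * \<kappa>) * (\<gamma> + \<sigma>)"
    using \<gamma> assms by (intro mult_pos_pos add_nonneg_pos) auto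
  with * have "0 < (1 - \<kappa>) * \<delta>" by linarith
  then show "\<kappa> < 1" using \<open>0 < \<delta>\<close> by (simp add: zero_less_mult_iff)
  have "(a + \<delta> * \<kappa>) * (\<gamma> + \<sigma>) \<le> (\<alpha> + \<delta> * \<kappa>) * (\<gamma> + \<sigma>)"
    using \<gamma> assms by (intro mult_right_mono) auto
  also note *
  finally have "(a + \<delta> * \<kappa>) * (\<gamma> + \<sigma>) \<le> (1 - \<kappa>) * \<delta>" .
  moreover have "0 < a + \<delta> * \<kappa>" using assms by (intro add_nonneg_pos) auto
  ultimately show "\<gamma> + \<sigma> \<le> (1 - \<kappa>) * \<delta> / (a + \<delta> * \<kappa>)"
    by (simp add: pos_le_divide_eq mult.commute)
qed

section \<open>Inertial Douglas--Rachford splitting in a renormed space\<close>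

text \<open>The map \<open>V\<close> supplies an equivalent inner product \<open>\<langle>x, V y\<rangle>\<close>, in which \<open>J1\<close> and \<open>J2\<close> are firmly
nonexpansive. That \<open>V\<close> preserves \<open>S\<close> ensures that weak convergence tested against \<open>S\<close> can be
transferred to this inner product.\<close>

locale firmly_nonexpansive_pair =
  fixes S :: "'a::{real_inner,banach} set" and V J1 J2 :: "'a \<Rightarrow> 'a" and c :: real
  assumes S: "subspace S" "closed S"
    and V: "bounded_linear V" "\<And>x y. x \<bullet> V y = y \<bullet> V x" "\<And>x. x \<in> S \<Longrightarrow> V x \<in> S"
    and coercive: "0 < c" "\<And>x. c * (norm x)\<^sup>2 \<le> x \<bullet> V x"
    and J_mem: "\<And>w. w \<in> S \<Longrightarrow> J1 w \<in> S" "\<And>w. w \<in> S \<Longrightarrow> J2 w \<in> S"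
    and J1_firm: "\<And>w w'. w \<in> S \<Longrightarrow> w' \<in> S \<Longrightarrow>
      0 \<le> (J1 w - J1 w') \<bullet> V ((w - w') - (J1 w - J1 w'))"
    and J2_firm: "\<And>w w'. w \<in> S \<Longrightarrow> w' \<in> S \<Longrightarrow>
      0 \<le> (J2 w - J2 w') \<bullet> V ((w - w') - (J2 w - J2 w'))"
begin

definition ipV :: "'a \<Rightarrow> 'a \<Rightarrow> real" where "ipV x y = x \<bullet> V y"

lemma ipV_commute: "ipV x y = ipV y x" unfolding ipV_def by (rule V(2))

lemma ipV_simps:
  "ipV (x + y) z = ipV x z + ipV y z" "ipV (x - y) z = ipV x z - ipV y z" "ipV (k *\<^sub>R x) z = k * ipV x z"
  "ipV x (y + z) = ipV x y + ipV x z" "ipV x (y - z) = ipV x y - ipV x z" "ipV x (k *\<^sub>R z) = k * ipV x z"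
  "ipV (- x) z = - ipV x z" "ipV x (- z) = - ipV x z" "ipV 0 x = 0" "ipV x 0 = 0"
  unfolding ipV_def
  by (simp_all add: inner_simps bounded_linear.linear[OF V(1)] linear_add linear_diff linear_neg
      linear_scale linear_0)

lemma ipV_coercive: "c * (norm x)\<^sup>2 \<le> ipV x x" unfolding ipV_def by (rule coercive(2))

lemma ipV_nonneg: "0 \<le> ipV x x"
  using ipV_coercive[of x] coercive(1) by (smt (verit) mult_nonneg_nonneg zero_le_power2)

lemma ipV_le_0_imp_eq_0:
  assumes "ipV x x \<le> 0"
  shows "x = 0"
proof -
  have "c * (norm x)\<^sup>2 \<le> 0" using ipV_coercive[of x] assms by linarith
  then show ?thesis using coercive(1) by (simp add: mult_le_0_iff)
qed

lemma ipV_bound: "\<bar>ipV x y\<bar> \<le> onorm V * norm x * norm y"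
proof -
  have "\<bar>ipV x y\<bar> \<le> norm x * norm (V y)" unfolding ipV_def by (rule Cauchy_Schwarz_ineq2)
  also have "\<dots> \<le> norm x * (onorm V * norm y)" by (intro mult_left_mono onorm V(1)) auto
  finally show ?thesis by (simp add: mult_ac)
qed

lemma ipV_tendsto_0:
  assumes "(f \<longlongrightarrow> 0) F" and bd: "\<And>n. norm (g n) \<le> M"
  shows "((\<lambda>n. ipV (f n) (g n)) \<longlongrightarrow> 0) F"
proof (rule Lim_null_comparison)
  show "\<forall>\<^sub>F n in F. norm (ipV (f n) (g n)) \<le> onorm V * norm (f n) * M"
  proof (intro always_eventually allI)
    fix n
    have "onorm V * norm (f n) * norm (g n) \<le> onorm V * norm (f n) * M"
      by (intro mult_left_mono bd mult_nonneg_nonneg onorm_pos_le V(1)) auto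
    then show "norm (ipV (f n) (g n)) \<le> onorm V * norm (f n) * M"
      using ipV_bound[of "f n" "g n"] by simp
  qed
  have "((\<lambda>n. onorm V * norm (f n) * M) \<longlongrightarrow> onorm V * 0 * M) F"
    using assms(1) by (intro tendsto_intros tendsto_norm_zero)
  then show "((\<lambda>n. onorm V * norm (f n) * M) \<longlongrightarrow> 0) F" by simp
qed

lemma S_arith:
  "x \<in> S \<Longrightarrow> y \<in> S \<Longrightarrow> x + y \<in> S" "x \<in> S \<Longrightarrow> y \<in> S \<Longrightarrow> x - y \<in> S" "x \<in> S \<Longrightarrow> k *\<^sub>R x \<in> S"
  using S(1) by (auto simp: subspace_add subspace_diff subspace_scale)

lemma firmly_nonexpansive_lipschitz:
  assumes firm: "0 \<le> ipV e (h - e)"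
  shows "norm e \<le> onorm V / c * norm h"
proof (cases "e = 0")
  case True
  then show ?thesis using onorm_pos_le[OF V(1)] coercive(1) by simp
next
  case False
  have "c * (norm e)\<^sup>2 \<le> ipV e h" using ipV_coercive[of e] firm by (simp add: ipV_simps)
  also have "\<dots> \<le> onorm V * norm e * norm h" using ipV_bound[of e h] by linarith
  finally have "norm e * (c * norm e) \<le> norm e * (onorm V * norm h)"
    by (simp add: power2_eq_square mult_ac)
  then have "c * norm e \<le> onorm V * norm h" using False by simp
  then show ?thesis using coercive(1) by (simp add: field_simps)
qed

lemmas J1_firm' = J1_firm[folded ipV_def] and J2_firm' = J2_firm[folded ipV_def]

text \<open>Adding the two firm nonexpansiveness inequalities for the current point and the fixed point gives
\<open>\<langle>h, f - e\<rangle> + \<parallel>f - e\<parallel>\<^sup>2 \<le> 0\<close> in the new inner product, where \<open>h\<close>, \<open>e\<close>, \<open>f\<close> are the deviations of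
the point and of its two images. This bounds the cross term \<open>\<langle>h, f - e\<rangle>\<close> in the expansion of the
squared distance after the step.\<close>

lemma relaxed_step_descent:
  assumes w: "w \<in> S" "ub \<in> S" and fixp: "J2 (2 *\<^sub>R J1 ub - ub) = J1 ub"
  defines "p \<equiv> J1 w"
  defines "z \<equiv> J2 (2 *\<^sub>R p - w)"
  assumes l: "0 \<le> l"
  shows "ipV (w + l *\<^sub>R (z - p) - ub) (w + l *\<^sub>R (z - p) - ub)
    \<le> ipV (w - ub) (w - ub) - l * (2 - l) * ipV (z - p) (z - p)"
proof -
  define e f h where "e = p - J1 ub" "f = z - J1 ub" "h = w - ub"
  note defs = e_f_h_def
  have "0 \<le> ipV e (h - e)" using J1_firm'[OF w] by (simp add: defs p_def)
  moreover have "0 \<le> ipV f ((2 *\<^sub>R e - h) - f)"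
  proof -
    have "2 *\<^sub>R p - w - (2 *\<^sub>R J1 ub - ub) = 2 *\<^sub>R e - h"
      by (simp add: defs algebra_simps)
    moreover have "0 \<le> ipV (J2 (2 *\<^sub>R p - w) - J2 (2 *\<^sub>R J1 ub - ub))
        ((2 *\<^sub>R p - w - (2 *\<^sub>R J1 ub - ub)) - (J2 (2 *\<^sub>R p - w) - J2 (2 *\<^sub>R J1 ub - ub)))"
      using w by (intro J2_firm') (auto simp: p_def S_arith J_mem)
    ultimately show ?thesis by (simp add: fixp flip: z_def defs(2))
  qed
  ultimately have "ipV h (f - e) + ipV (f - e) (f - e) \<le> 0"
    by (simp add: ipV_simps ipV_commute)
  then have "2 * l * (ipV h (f - e) + ipV (f - e) (f - e)) \<le> 0"
    using l by (simp add: mult_nonneg_nonpos)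
  moreover have step: "w + l *\<^sub>R (z - p) - ub = h + l *\<^sub>R (f - e)" "z - p = f - e"
    by (simp_all add: defs)
  have "ipV (h + l *\<^sub>R (f - e)) (h + l *\<^sub>R (f - e))
      = ipV h h - l * (2 - l) * ipV (f - e) (f - e) + 2 * l * (ipV h (f - e) + ipV (f - e) (f - e))"
    by (simp add: ipV_simps ipV_commute algebra_simps)
  ultimately show ?thesis unfolding step(1) unfolding step(2) defs(3)[symmetric] by linarith
qed

end

text \<open>Here \<open>d\<close> and \<open>d'\<close> stand for the squared norms of two consecutive increments, \<open>r\<close> for their inner product
and \<open>\<kappa>\<close> for half the relaxation parameter. The bound on \<open>r\<close> is Young's inequality with weight
\<open>a + \<delta> * \<kappa>\<close>; with this weight \<open>\<kappa>\<close> factors out of the lower bound for the residual.\<close>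

lemma inertial_coefficients_bound:
  fixes \<alpha> \<delta> \<sigma> \<kappa> a d d' r :: real
  defines "\<gamma> \<equiv> \<alpha> * (1 + \<alpha>) + \<alpha> * \<delta>"
  assumes "0 \<le> a" "a \<le> \<alpha>" "0 < \<delta>" "0 < \<sigma>" "0 < \<kappa>"
    and \<kappa>: "\<kappa> \<le> (\<delta> - \<alpha> * (\<gamma> + \<sigma>)) / (\<delta> * (1 + (\<gamma> + \<sigma>)))"
    and d: "0 \<le> d" "0 \<le> d'"
    and cross: "2 * r \<le> d' / (a + \<delta> * \<kappa>) + (a + \<delta> * \<kappa>) * d"
  shows "a * (1 + a) * d - (1 - \<kappa>) / \<kappa> * (d' - 2 * a * r + a\<^sup>2 * d) \<le> \<gamma> * d - (\<gamma> + \<sigma>) * d'"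
proof -
  define R where "R = a + \<delta> * \<kappa>"
  have R: "0 < R" unfolding R_def using assms by (intro add_nonneg_pos) auto
  have \<kappa>1: "\<kappa> < 1" "\<gamma> + \<sigma> \<le> (1 - \<kappa>) * \<delta> / R"
    using relaxation_coefficient[of a \<alpha> \<delta> \<sigma> \<kappa>] assms(2-7) by (simp_all add: \<gamma>_def R_def)
  have "a * (2 * r) \<le> a * (d' / R + R * d)"
    using cross \<open>0 \<le> a\<close> unfolding R_def by (rule mult_left_mono)
  then have "d' - a * (d' / R + R * d) + a\<^sup>2 * d \<le> d' - 2 * a * r + a\<^sup>2 * d" by simp
  also have "d' - a * (d' / R + R * d) + a\<^sup>2 * d = \<kappa> * (\<delta> / R * d' - a * \<delta> * d)"
  proof -
    have "d' - a * (d' / R) = \<kappa> * (\<delta> / R * d')"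
    proof -
      have "d' = (a + \<delta> * \<kappa>) * d' / R" using R by (simp add: R_def)
      then show ?thesis by (simp add: field_simps add_divide_distrib)
    qed
    then show ?thesis by (simp add: R_def algebra_simps power2_eq_square)
  qed
  finally have "(1 - \<kappa>) / \<kappa> * (\<kappa> * (\<delta> / R * d' - a * \<delta> * d))
      \<le> (1 - \<kappa>) / \<kappa> * (d' - 2 * a * r + a\<^sup>2 * d)"
    using \<kappa>1(1) \<open>0 < \<kappa>\<close> by (intro mult_left_mono) auto
  moreover have "(1 - \<kappa>) / \<kappa> * (\<kappa> * (\<delta> / R * d' - a * \<delta> * d))
      = (1 - \<kappa>) * \<delta> / R * d' - (1 - \<kappa>) * (a * \<delta> * d)"
    using \<open>0 < \<kappa>\<close> by (simp add: right_diff_distrib)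
  moreover have "(\<gamma> + \<sigma>) * d' \<le> (1 - \<kappa>) * \<delta> / R * d'"
    by (intro mult_right_mono \<kappa>1 d)
  moreover have "(1 - \<kappa>) * (a * \<delta> * d) \<le> 1 * (\<alpha> * \<delta> * d)"
    using assms \<kappa>1 by (intro mult_mono) auto
  moreover have "a * (1 + a) * d \<le> \<alpha> * (1 + \<alpha>) * d"
    using assms by (intro mult_right_mono mult_mono) auto
  ultimately show ?thesis unfolding \<gamma>_def by (simp add: algebra_simps)
qed

text \<open>Indices are shifted by one with respect to the usual numbering: \<open>w n\<close>, \<open>p n\<close> and \<open>z n\<close> are computed from
\<open>u n\<close> and \<open>u (n + 1)\<close>, so that no predecessor of an index occurs.\<close>

locale inertial_iteration = firmly_nonexpansive_pair S V J1 J2 c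
  for S :: "'a::{real_inner,banach} set" and V J1 J2 c +
  fixes u w p z :: "nat \<Rightarrow> 'a" and a l :: "nat \<Rightarrow> real" and \<alpha> \<delta> \<sigma> lmin :: real
  assumes u_init: "u 0 \<in> S" "u (Suc 0) \<in> S"
    and w: "\<And>n. w n = u (Suc n) + a n *\<^sub>R (u (Suc n) - u n)"
    and p: "\<And>n. p n = J1 (w n)"
    and z: "\<And>n. z n = J2 (2 *\<^sub>R p n - w n)"
    and u_step: "\<And>n. u (Suc (Suc n)) = w n + l n *\<^sub>R (z n - p n)"
    and a: "\<And>n. 0 \<le> a n" "\<And>n. a n \<le> \<alpha>" "\<And>n. a n \<le> a (Suc n)" and \<alpha>: "\<alpha> < 1"
    and \<delta>: "0 < \<delta>" and \<sigma>: "0 < \<sigma>"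
    and l: "0 < lmin" "\<And>n. lmin \<le> l n"
      "\<And>n. l n \<le> 2 * ((\<delta> - \<alpha> * (\<alpha> * (1 + \<alpha>) + \<alpha> * \<delta> + \<sigma>)) /
                     (\<delta> * (1 + \<alpha> * (1 + \<alpha>) + \<alpha> * \<delta> + \<sigma>)))"
    and fixed_point_exists: "\<exists>ub\<in>S. J2 (2 *\<^sub>R J1 ub - ub) = J1 ub"
begin

lemma iterates_mem: "u n \<in> S" "w n \<in> S" "p n \<in> S" "z n \<in> S"
proof -
  have w_mem: "w n \<in> S" if "u n \<in> S" "u (Suc n) \<in> S" for n
    using that by (simp add: w S_arith)
  have p_mem: "p n \<in> S" if "w n \<in> S" for n using that by (simp add: p J_mem)
  have z_mem: "z n \<in> S" if "w n \<in> S" for n using that p_mem by (simp add: z J_mem S_arith)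
  have "u n \<in> S \<and> u (Suc n) \<in> S"
    by (induction n) (auto simp: u_init u_step S_arith w_mem p_mem z_mem)
  then show "u n \<in> S" "w n \<in> S" "p n \<in> S" "z n \<in> S" using w_mem p_mem z_mem by auto
qed

lemma distance_recursion:
  assumes ub: "ub \<in> S" "J2 (2 *\<^sub>R J1 ub - ub) = J1 ub"
  defines "\<phi> \<equiv> \<lambda>n. ipV (u n - ub) (u n - ub)"
  defines "D \<equiv> \<lambda>n. ipV (u (Suc n) - u n) (u (Suc n) - u n)"
  defines "\<gamma> \<equiv> \<alpha> * (1 + \<alpha>) + \<alpha> * \<delta>"
  shows "\<phi> (Suc (Suc n)) \<le> \<phi> (Suc n) + a n * (\<phi> (Suc n) - \<phi> n) + \<gamma> * D n - (\<gamma> + \<sigma>) * D (Suc n)"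
proof -
  define \<kappa> where "\<kappa> = l n / 2"
  have \<kappa>: "0 < \<kappa>" using l(1) l(2)[of n] by (simp add: \<kappa>_def)
  define X d d' where "X = u (Suc n) - ub" "d = u (Suc n) - u n" "d' = u (Suc (Suc n)) - u (Suc n)"
  note defs = X_d_d'_def
  have D_eq: "D n = ipV d d" "D (Suc n) = ipV d' d'" by (simp_all add: D_def defs)
  have d'_eq: "d' - a n *\<^sub>R d = l n *\<^sub>R (z n - p n)" by (simp add: defs u_step w)
  have w_eq: "w n - ub = X + a n *\<^sub>R d" and X_eq: "u n - ub = X - d" by (simp_all add: defs w)
  have "\<phi> (Suc (Suc n)) \<le> ipV (w n - ub) (w n - ub) - l n * (2 - l n) * ipV (z n - p n) (z n - p n)"
    using relaxed_step_descent[OF iterates_mem(2)[of n] ub, of "l n"] l(1) l(2)[of n]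
    by (simp add: \<phi>_def u_step p z)
  moreover have "ipV (w n - ub) (w n - ub) = \<phi> (Suc n) + a n * (\<phi> (Suc n) - \<phi> n) + a n * (1 + a n) * D n"
    unfolding w_eq \<phi>_def D_def X_eq by (simp add: ipV_simps ipV_commute algebra_simps flip: defs)
  moreover have "l n * (2 - l n) * ipV (z n - p n) (z n - p n)
      = (1 - \<kappa>) / \<kappa> * (D (Suc n) - 2 * a n * ipV d d' + (a n)\<^sup>2 * D n)"
  proof -
    have "l n * (2 - l n) * ipV (z n - p n) (z n - p n)
        = (1 - \<kappa>) / \<kappa> * ipV (d' - a n *\<^sub>R d) (d' - a n *\<^sub>R d)"
      unfolding d'_eq using \<kappa> by (simp add: \<kappa>_def ipV_simps field_simps)
    also have "ipV (d' - a n *\<^sub>R d) (d' - a n *\<^sub>R d) = D (Suc n) - 2 * a n * ipV d d' + (a n)\<^sup>2 * D n"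
      by (simp add: D_eq ipV_simps ipV_commute power2_eq_square)
    finally show ?thesis .
  qed
  moreover have "a n * (1 + a n) * D n - (1 - \<kappa>) / \<kappa> * (D (Suc n) - 2 * a n * ipV d d' + (a n)\<^sup>2 * D n)
      \<le> \<gamma> * D n - (\<gamma> + \<sigma>) * D (Suc n)"
    unfolding \<gamma>_def
  proof (rule inertial_coefficients_bound)
    show "\<kappa> \<le> (\<delta> - \<alpha> * (\<alpha> * (1 + \<alpha>) + \<alpha> * \<delta> + \<sigma>)) /
        (\<delta> * (1 + (\<alpha> * (1 + \<alpha>) + \<alpha> * \<delta> + \<sigma>)))"
      using l(3)[of n] unfolding \<kappa>_def add.assoc[symmetric] by linarith
    define R where "R = a n + \<delta> * \<kappa>"
    have R: "0 < R" unfolding R_def using a(1)[of n] \<delta> \<kappa> by (intro add_nonneg_pos) auto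
    have "0 \<le> ipV (d' - R *\<^sub>R d) (d' - R *\<^sub>R d) / R" using R ipV_nonneg by simp
    also have "\<dots> = D (Suc n) / R - 2 * ipV d d' + R * D n"
      using R by (simp add: D_eq ipV_simps ipV_commute field_simps)
    finally show "2 * ipV d d' \<le> D (Suc n) / (a n + \<delta> * \<kappa>) + (a n + \<delta> * \<kappa>) * D n"
      by (simp add: R_def)
  qed (use a \<delta> \<sigma> \<kappa> in \<open>auto simp: D_def ipV_nonneg\<close>)
  ultimately show ?thesis by linarith
qed

lemma summable_and_distance_convergent:
  assumes ub: "ub \<in> S" "J2 (2 *\<^sub>R J1 ub - ub) = J1 ub"
  shows "summable (\<lambda>n. (norm (u (Suc n) - u n))\<^sup>2)" "convergent (\<lambda>n. ipV (u n - ub) (u n - ub))"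
proof -
  define D where "D = (\<lambda>n. ipV (u (Suc n) - u n) (u (Suc n) - u n))"
  have \<alpha>0: "0 \<le> \<alpha>" using a(1)[of 0] a(2)[of 0] by linarith
  have "summable D" and conv: "convergent (\<lambda>n. ipV (u n - ub) (u n - ub))"
    using inertial_descent[of "\<lambda>n. ipV (u n - ub) (u n - ub)" D a \<alpha> "\<alpha> * (1 + \<alpha>) + \<alpha> * \<delta>" \<sigma>]
      distance_recursion[OF ub] a \<alpha> \<sigma> \<alpha>0 \<delta> by (simp_all add: D_def ipV_nonneg)
  then show "convergent (\<lambda>n. ipV (u n - ub) (u n - ub))" by simp
  have "summable (\<lambda>n. D n / c)" using \<open>summable D\<close> by (rule summable_divide)
  moreover have "norm ((norm (u (Suc n) - u n))\<^sup>2) \<le> D n / c" for n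
    using ipV_coercive[of "u (Suc n) - u n"] coercive(1) by (simp add: D_def field_simps)
  ultimately show "summable (\<lambda>n. (norm (u (Suc n) - u n))\<^sup>2)" by (rule summable_comparison_test'[of _ 0])
qed

lemma increments_tendsto_0: "(\<lambda>n. u (Suc n) - u n) \<longlonglongrightarrow> 0"
proof -
  obtain ub where "ub \<in> S" "J2 (2 *\<^sub>R J1 ub - ub) = J1 ub" using fixed_point_exists by blast
  then have "(\<lambda>n. (norm (u (Suc n) - u n))\<^sup>2) \<longlonglongrightarrow> 0"
    by (intro summable_LIMSEQ_zero summable_and_distance_convergent)
  then have "(\<lambda>n. norm (u (Suc n) - u n)) \<longlonglongrightarrow> 0"
    using tendsto_real_sqrt by fastforce
  then show ?thesis by (rule tendsto_norm_zero_cancel)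
qed

lemma extrapolation_tendsto_0: "(\<lambda>n. w n - u (Suc n)) \<longlonglongrightarrow> 0"
proof (rule Lim_null_comparison)
  show "\<forall>\<^sub>F n in sequentially. norm (w n - u (Suc n)) \<le> norm (u (Suc n) - u n)"
  proof (intro always_eventually allI)
    fix n
    have "a n \<le> 1" using a(2)[of n] \<alpha> by linarith
    then show "norm (w n - u (Suc n)) \<le> norm (u (Suc n) - u n)"
      using a(1)[of n] by (simp add: w mult_left_le_one_le)
  qed
qed (intro tendsto_norm_zero increments_tendsto_0)

lemma residual_tendsto_0: "(\<lambda>n. z n - p n) \<longlonglongrightarrow> 0"
proof (rule Lim_null_comparison)
  let ?g = "\<lambda>n. norm (u (Suc (Suc n)) - w n) / lmin"
  show "\<forall>\<^sub>F n in sequentially. norm (z n - p n) \<le> ?g n"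
  proof (intro always_eventually allI)
    fix n
    have "lmin * norm (z n - p n) \<le> l n * norm (z n - p n)" by (intro mult_right_mono l) simp
    also have "\<dots> = norm (u (Suc (Suc n)) - w n)" using l(1) l(2)[of n] by (simp add: u_step)
    finally show "norm (z n - p n) \<le> ?g n" using l(1) by (simp add: field_simps)
  qed
  have "(\<lambda>n. (u (Suc (Suc n)) - u (Suc n)) - (w n - u (Suc n))) \<longlonglongrightarrow> 0 - 0"
    using increments_tendsto_0 extrapolation_tendsto_0
    by (intro tendsto_diff) (rule LIMSEQ_Suc)
  then have "(\<lambda>n. u (Suc (Suc n)) - w n) \<longlonglongrightarrow> 0" by simp
  then show "?g \<longlonglongrightarrow> 0" using tendsto_divide_zero tendsto_norm_zero by blast
qed

text \<open>Boundedness of \<open>u\<close> follows from the convergent distance to one fixed point, that of \<open>p\<close> from the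
Lipschitz continuity of \<open>J1\<close>.\<close>

lemma iterates_bounded: "\<exists>M. (\<forall>n. norm (w n) \<le> M) \<and> (\<forall>n. norm (p n) \<le> M)"
proof -
  obtain ub where ub: "ub \<in> S" "J2 (2 *\<^sub>R J1 ub - ub) = J1 ub" using fixed_point_exists by blast
  have "Bseq (\<lambda>n. ipV (u n - ub) (u n - ub))"
    using summable_and_distance_convergent(2)[OF ub] by (rule convergent_imp_Bseq)
  then obtain K where K: "\<And>n. \<bar>ipV (u n - ub) (u n - ub)\<bar> \<le> K" unfolding Bseq_def by auto
  define R where "R = norm ub + sqrt (K / c)"
  have u_bd: "norm (u n) \<le> R" for n
  proof -
    have "c * (norm (u n - ub))\<^sup>2 \<le> K" using ipV_coercive[of "u n - ub"] K[of n] by linarith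
    then have "norm (u n - ub) \<le> sqrt (K / c)"
      using coercive(1) by (intro real_le_rsqrt) (simp add: field_simps)
    then show ?thesis using norm_triangle_sub[of "u n" ub] unfolding R_def by linarith
  qed
  define M where "M = 3 * R"
  have w_bd: "norm (w n) \<le> M" for n
  proof -
    have "a n * norm (u (Suc n) - u n) \<le> 1 * norm (u (Suc n) - u n)"
      using a(2)[of n] \<alpha> by (intro mult_right_mono) auto
    then have "norm (w n) \<le> norm (u (Suc n)) + norm (u (Suc n) - u n)"
      unfolding w using a(1)[of n] norm_triangle_ineq[of "u (Suc n)" "a n *\<^sub>R (u (Suc n) - u n)"] by simp
    then show ?thesis
      using u_bd[of n] u_bd[of "Suc n"] norm_triangle_ineq4[of "u (Suc n)" "u n"]
      unfolding M_def by linarith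
  qed
  have p_bd: "norm (p n) \<le> norm (J1 ub) + onorm V / c * (M + norm ub)" for n
  proof -
    have "norm (p n - J1 ub) \<le> onorm V / c * norm (w n - ub)"
      unfolding p by (intro firmly_nonexpansive_lipschitz J1_firm' iterates_mem ub)
    also have "\<dots> \<le> onorm V / c * (M + norm ub)"
      using w_bd[of n] norm_triangle_ineq4[of "w n" ub] onorm_pos_le[OF V(1)] coercive(1)
      by (intro mult_left_mono) auto
    finally show ?thesis using norm_triangle_sub[of "p n" "J1 ub"] by linarith
  qed
  show ?thesis
    by (rule exI[of _ "max M (norm (J1 ub) + onorm V / c * (M + norm ub))"])
      (use w_bd p_bd in \<open>auto simp: le_max_iff_disj\<close>)
qed

lemma residual_pairing_tendsto_0: "(\<lambda>n. ipV (z n - p n) ((w n - ub) + (z n - p n))) \<longlonglongrightarrow> 0"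
proof -
  obtain M where M: "\<And>n. norm (w n) \<le> M" using iterates_bounded by auto
  have "Bseq (\<lambda>n. z n - p n)"
    using residual_tendsto_0 by (intro convergent_imp_Bseq) (auto simp: convergent_def)
  then obtain K where K: "\<And>n. norm (z n - p n) \<le> K" unfolding Bseq_def by auto
  have "norm ((w n - ub) + (z n - p n)) \<le> (M + norm ub) + K" for n
    using norm_triangle_ineq[of "w n - ub" "z n - p n"] norm_triangle_ineq4[of "w n" ub] M[of n] K[of n]
    by linarith
  then show ?thesis by (rule ipV_tendsto_0[OF residual_tendsto_0])
qed

text \<open>Products of two weakly convergent sequences have no limit in general. In the sum of the two firm
nonexpansiveness inequalities at a pair of test points they all cancel, up to products with the
residual, which tends to zero in norm.\<close>

lemma paired_inequality_expansion:
  fixes ub y a1 a2 :: 'a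
  defines "W \<equiv> \<lambda>n. w n - ub" and "P \<equiv> \<lambda>n. p n - y" and "Z \<equiv> \<lambda>n. z n - y"
    and "s \<equiv> y - a1" and "t \<equiv> y - a2"
  shows "ipV (p n - a1) ((w n - ub) - (p n - a1))
      + ipV (z n - a2) ((2 *\<^sub>R p n - w n - (2 *\<^sub>R y - ub)) - (z n - a2))
    = ipV (W n) (s - t) + 2 * ipV (P n) (t - s) - 2 * ipV (Z n) t - ipV s s - ipV t t
      - ipV (z n - p n) (W n + (z n - p n))"
proof -
  have "w n = W n + ub" "p n = P n + y" "z n = Z n + y" "a1 = y - s" "a2 = y - t"
    by (simp_all add: W_def P_def Z_def s_def t_def)
  then have *: "p n - a1 = P n + s" "w n - ub = W n" "z n - a2 = Z n + t" "z n - p n = Z n - P n"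
    "2 *\<^sub>R p n - w n - (2 *\<^sub>R y - ub) = 2 *\<^sub>R P n - W n"
    by (simp_all add: algebra_simps)
  show ?thesis unfolding * by (simp add: ipV_simps ipV_commute algebra_simps)
qed

lemma weak_tendsto_b:
  assumes "\<And>y. y \<in> S \<Longrightarrow> ((\<lambda>n. X n \<bullet> y) \<longlongrightarrow> x \<bullet> y) F" "y \<in> S"
  shows "((\<lambda>n. ipV (X n - x) y) \<longlongrightarrow> 0) F"
  using tendsto_diff[OF assms(1)[OF V(3)[OF assms(2)]] tendsto_const[of "x \<bullet> V y"]]
  by (simp add: ipV_def inner_diff_left)

text \<open>Let \<open>w\<close> and \<open>p\<close> converge weakly along a filter to \<open>ub\<close> and \<open>y\<close>. Testing with the resolvent points
\<open>J1 ub\<close> and \<open>J2 (2 y - ub)\<close>, the nonnegative sum of the two inequalities tends to minus the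
sum of the squared distances of \<open>y\<close> to these points; hence \<open>y\<close> equals both of them. This identifies the weak
limit of \<open>p\<close> although \<open>J1\<close> is not weakly continuous.\<close>

lemma weak_cluster_point:
  assumes F: "F \<le> sequentially" "F \<noteq> bot"
  shows "\<exists>F' ub. F' \<le> F \<and> F' \<noteq> bot \<and> ub \<in> S \<and> J2 (2 *\<^sub>R J1 ub - ub) = J1 ub \<and>
    (\<forall>y\<in>S. ((\<lambda>n. w n \<bullet> y) \<longlongrightarrow> ub \<bullet> y) F') \<and>
    (\<forall>y\<in>S. ((\<lambda>n. p n \<bullet> y) \<longlongrightarrow> J1 ub \<bullet> y) F')"
proof -
  obtain M where M: "\<And>n. norm (w n) \<le> M" "\<And>n. norm (p n) \<le> M"
    using iterates_bounded by auto
  obtain F1 ub where F1: "F1 \<le> F" "F1 \<noteq> bot" and ub: "ub \<in> S"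
    and w_lim1: "\<forall>y\<in>S. ((\<lambda>n. w n \<bullet> y) \<longlongrightarrow> ub \<bullet> y) F1"
    using bounded_weak_cluster_point[OF S F(2), of w M] M(1) by metis
  obtain F2 y where F2: "F2 \<le> F1" "F2 \<noteq> bot" and y: "y \<in> S"
    and p_lim_ball: "\<forall>s\<in>S. ((\<lambda>n. p n \<bullet> s) \<longlongrightarrow> y \<bullet> s) F2"
    using bounded_weak_cluster_point[OF S F1(2), of p M] M(2) by metis
  have w_lim: "((\<lambda>n. w n \<bullet> s) \<longlongrightarrow> ub \<bullet> s) F2" if "s \<in> S" for s
    using F2(1) bspec[OF w_lim1 that] by (rule tendsto_mono)
  note p_lim = bspec[OF p_lim_ball]
  have "F2 \<le> sequentially" using F2(1) F1(1) F(1) by simp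
  then have e_lim: "((\<lambda>n. z n - p n) \<longlongrightarrow> 0) F2"
    using residual_tendsto_0 by (rule tendsto_mono)
  have z_lim: "((\<lambda>n. z n \<bullet> s) \<longlongrightarrow> y \<bullet> s) F2" if "s \<in> S" for s
    using tendsto_add[OF p_lim[OF that] tendsto_inner[OF e_lim tendsto_const[of s]]]
    by (simp add: inner_diff_left)
  define a1 a2 where "a1 = J1 ub" "a2 = J2 (2 *\<^sub>R y - ub)"
  have a12: "a1 \<in> S" "a2 \<in> S" using ub y by (simp_all add: a1_a2_def J_mem S_arith)
  let ?E = "\<lambda>n. ipV (p n - a1) ((w n - ub) - (p n - a1))
      + ipV (z n - a2) ((2 *\<^sub>R p n - w n - (2 *\<^sub>R y - ub)) - (z n - a2))"
  have E_nonneg: "0 \<le> ?E n" for n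
    using J1_firm'[OF iterates_mem(2) ub, of n]
      J2_firm'[of "2 *\<^sub>R p n - w n" "2 *\<^sub>R y - ub"] iterates_mem y ub
    by (intro add_nonneg_nonneg) (simp_all add: a1_a2_def p z S_arith J_mem)
  have "((\<lambda>n. ipV (z n - p n) ((w n - ub) + (z n - p n))) \<longlongrightarrow> 0) F2"
    using \<open>F2 \<le> sequentially\<close> residual_pairing_tendsto_0 by (rule tendsto_mono)
  moreover have "(y - a1) - (y - a2) \<in> S" "(y - a2) - (y - a1) \<in> S" "y - a2 \<in> S"
    using a12 y by (auto intro!: S_arith)
  ultimately have "(?E \<longlongrightarrow> 0 + 2 * 0 - 2 * 0 - ipV (y - a1) (y - a1) - ipV (y - a2) (y - a2) - 0) F2"
    unfolding paired_inequality_expansion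
    by (intro tendsto_intros weak_tendsto_b w_lim p_lim z_lim)
  then have "0 \<le> 0 + 2 * 0 - 2 * 0 - ipV (y - a1) (y - a1) - ipV (y - a2) (y - a2) - 0"
    by (rule tendsto_lowerbound) (use E_nonneg F2(2) in \<open>auto intro!: always_eventually\<close>)
  then have "ipV (y - a1) (y - a1) \<le> 0" "ipV (y - a2) (y - a2) \<le> 0"
    using ipV_nonneg[of "y - a1"] ipV_nonneg[of "y - a2"] by linarith+
  then have "y = a1" "y = a2"
    using ipV_le_0_imp_eq_0[of "y - a1"] ipV_le_0_imp_eq_0[of "y - a2"] by simp_all
  then have J1_y: "J1 ub = y" and "J2 (2 *\<^sub>R y - ub) = y"
    unfolding a1_a2_def by (metis, metis)
  then have "J2 (2 *\<^sub>R J1 ub - ub) = J1 ub" by simp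
  moreover have "F2 \<le> F" using F2(1) F1(1) by simp
  ultimately show ?thesis using F2(2) ub w_lim p_lim[folded J1_y] by blast
qed

text \<open>Opial's argument: the difference of the squared distances to two cluster points converges and is affine in
the iterate, so its limits along the two filters agree, which forces the cluster points to coincide. The last
conclusion measures the monotonicity gap of \<open>J1\<close> between \<open>w n\<close> and the limit; it is one of two
nonnegative terms whose sum tends to zero.\<close>

theorem weak_convergence:
  "\<exists>ub\<in>S. J2 (2 *\<^sub>R J1 ub - ub) = J1 ub \<and>
    (\<forall>y\<in>S. (\<lambda>n. u n \<bullet> y) \<longlonglongrightarrow> ub \<bullet> y) \<and>
    (\<forall>y\<in>S. (\<lambda>n. p n \<bullet> y) \<longlonglongrightarrow> J1 ub \<bullet> y) \<and>
    (\<forall>y\<in>S. (\<lambda>n. z n \<bullet> y) \<longlonglongrightarrow> J1 ub \<bullet> y) \<and>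
    (\<lambda>n. (p n - J1 ub) \<bullet> V ((w n - ub) - (p n - J1 ub))) \<longlonglongrightarrow> 0"
proof -
  obtain F0 ub where F0: "F0 \<le> sequentially" "F0 \<noteq> bot"
    and ub: "ub \<in> S" "J2 (2 *\<^sub>R J1 ub - ub) = J1 ub"
    and lim0: "\<forall>y\<in>S. ((\<lambda>n. w n \<bullet> y) \<longlongrightarrow> ub \<bullet> y) F0"
    using weak_cluster_point[OF order_refl sequentially_bot] by metis
  have cluster: "\<exists>F''. F'' \<le> F' \<and> F'' \<noteq> bot \<and>
      (\<forall>y\<in>S. ((\<lambda>n. w n \<bullet> y) \<longlongrightarrow> ub \<bullet> y) F'' \<and> ((\<lambda>n. p n \<bullet> y) \<longlongrightarrow> J1 ub \<bullet> y) F'')"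
    if F': "F' \<le> sequentially" "F' \<noteq> bot" for F'
  proof -
    obtain F'' u' where F'': "F'' \<le> F'" "F'' \<noteq> bot"
      and u': "u' \<in> S" "J2 (2 *\<^sub>R J1 u' - u') = J1 u'"
      and lim: "\<forall>y\<in>S. ((\<lambda>n. w n \<bullet> y) \<longlongrightarrow> u' \<bullet> y) F''"
        "\<forall>y\<in>S. ((\<lambda>n. p n \<bullet> y) \<longlongrightarrow> J1 u' \<bullet> y) F''"
      using weak_cluster_point[OF F'] by metis
    define s where "s = ub - u'"
    have s: "s \<in> S" using ub u' by (simp add: s_def S_arith)
    have "convergent (\<lambda>n. ipV (u n - u') (u n - u') - ipV (u n - ub) (u n - ub))"
      by (intro convergent_diff summable_and_distance_convergent ub u')
    then obtain L where "(\<lambda>n. ipV (u n - u') (u n - u') - ipV (u n - ub) (u n - ub)) \<longlonglongrightarrow> L"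
      by (auto simp: convergent_def)
    from LIMSEQ_Suc[OF this]
    have "(\<lambda>n. 2 * ipV (u (Suc n)) s + (ipV u' u' - ipV ub ub)) \<longlonglongrightarrow> L"
      by (simp add: s_def ipV_simps ipV_commute algebra_simps)
    from tendsto_diff[OF this tendsto_const[of "ipV u' u' - ipV ub ub"]]
    have "(\<lambda>n. 2 * ipV (u (Suc n)) s / 2) \<longlonglongrightarrow> (L - (ipV u' u' - ipV ub ub)) / 2"
      by (intro tendsto_divide) simp_all
    then have "(\<lambda>n. ipV (u (Suc n)) s) \<longlonglongrightarrow> (L - (ipV u' u' - ipV ub ub)) / 2" by simp
    moreover have "(\<lambda>n. ipV (w n - u (Suc n)) s) \<longlonglongrightarrow> 0"
      by (rule ipV_tendsto_0[OF extrapolation_tendsto_0, of _ "norm s"]) simp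
    ultimately have "(\<lambda>n. ipV (u (Suc n)) s + ipV (w n - u (Suc n)) s)
        \<longlonglongrightarrow> (L - (ipV u' u' - ipV ub ub)) / 2 + 0"
      by (rule tendsto_add)
    then obtain L' where L': "(\<lambda>n. ipV (w n) s) \<longlonglongrightarrow> L'" by (simp add: ipV_simps)
    have "L' = ipV ub s"
      using tendsto_unique[OF F0(2) tendsto_mono[OF F0(1) L']] bspec[OF lim0 V(3)[OF s]] by (simp add: ipV_def)
    moreover have "L' = ipV u' s"
      using tendsto_unique[OF F''(2) tendsto_mono[OF _ L']] bspec[OF lim(1) V(3)[OF s]] F''(1) F'(1)
      by (simp add: ipV_def)
    ultimately have "ipV s s = 0" by (simp add: s_def ipV_simps)
    then have "u' = ub" using ipV_le_0_imp_eq_0[of s] by (simp add: s_def)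
    then show ?thesis using F'' lim by blast
  qed
  have w_lim: "(\<lambda>n. w n \<bullet> y) \<longlonglongrightarrow> ub \<bullet> y" and p_lim: "(\<lambda>n. p n \<bullet> y) \<longlonglongrightarrow> J1 ub \<bullet> y" if "y \<in> S" for y
    using cluster that by (intro tendsto_if_subfilters_tendsto; blast)+
  have z_lim: "(\<lambda>n. z n \<bullet> y) \<longlonglongrightarrow> J1 ub \<bullet> y" if "y \<in> S" for y
    using tendsto_add[OF p_lim[OF that] tendsto_inner[OF residual_tendsto_0 tendsto_const[of y]]]
    by (simp add: inner_diff_left)
  have u_lim: "(\<lambda>n. u n \<bullet> y) \<longlonglongrightarrow> ub \<bullet> y" if "y \<in> S" for y
  proof -
    have "(\<lambda>n. u (Suc n) \<bullet> y) \<longlonglongrightarrow> ub \<bullet> y"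
      using tendsto_diff[OF w_lim[OF that] tendsto_inner[OF extrapolation_tendsto_0 tendsto_const[of y]]]
      by (simp add: inner_diff_left)
    then show ?thesis by (rule LIMSEQ_imp_Suc)
  qed
  define y where "y = J1 ub"
  let ?f = "\<lambda>n. ipV (p n - y) ((w n - ub) - (p n - y))"
  let ?g = "\<lambda>n. ipV (z n - y) ((2 *\<^sub>R p n - w n - (2 *\<^sub>R y - ub)) - (z n - y))"
  have f_nonneg: "0 \<le> ?f n" for n
    using J1_firm'[OF iterates_mem(2) ub(1), of n] by (simp add: p y_def)
  have g_nonneg: "0 \<le> ?g n" for n
    using J2_firm'[of "2 *\<^sub>R p n - w n" "2 *\<^sub>R y - ub"] iterates_mem ub
    by (simp add: z y_def S_arith J_mem)
  have sum_lim: "(\<lambda>n. ?f n + ?g n) \<longlonglongrightarrow> 0"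
  proof -
    have "(\<lambda>n. ipV (z n - p n) ((w n - ub) + (z n - p n))) \<longlonglongrightarrow> 0"
      by (rule residual_pairing_tendsto_0)
    from tendsto_minus[OF this] show ?thesis
      unfolding paired_inequality_expansion by (simp add: ipV_simps)
  qed
  have "?f \<longlonglongrightarrow> 0"
    by (rule tendsto_sandwich[OF _ _ tendsto_const sum_lim])
      (use f_nonneg g_nonneg in \<open>auto intro!: always_eventually\<close>)
  then have "(\<lambda>n. (p n - J1 ub) \<bullet> V ((w n - ub) - (p n - J1 ub))) \<longlonglongrightarrow> 0"
    by (simp add: ipV_def y_def)
  with ub u_lim p_lim z_lim show ?thesis by blast
qed

end

section \<open>The primal-dual problem in the product space\<close>

text \<open>If the distance were at least \<open>\<epsilon>\<close> infinitely often, the gap would be at least \<open>\<phi> \<epsilon> > 0\<close> infinitely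
often, since the modulus \<open>\<phi>\<close> is nondecreasing.\<close>

lemma uniformly_monotone_convergence:
  fixes A :: "'a::real_inner \<Rightarrow> 'a set"
  assumes "uniformly_monotone A" and a: "\<And>n. a n \<in> A (p n)" "ab \<in> A pb"
    and lim: "(\<lambda>n. (p n - pb) \<bullet> (a n - ab)) \<longlonglongrightarrow> 0"
  shows "p \<longlonglongrightarrow> pb"
proof (rule tendstoI)
  fix \<epsilon> :: real assume \<epsilon>: "0 < \<epsilon>"
  obtain \<phi> :: "real \<Rightarrow> ereal" where \<phi>: "mono_on {0..} \<phi>" "\<forall>t\<ge>0. 0 \<le> \<phi> t" "\<forall>t\<ge>0. \<phi> t = 0 \<longleftrightarrow> t = 0"
    and mono: "\<forall>(x, u)\<in>Gr A. \<forall>(y, v)\<in>Gr A. \<phi> (norm (x - y)) \<le> ereal ((x - y) \<bullet> (u - v))"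
    using assms(1) unfolding uniformly_monotone_def by blast
  have "0 < \<phi> \<epsilon>" using \<phi>(2,3) \<epsilon> by (metis less_eq_real_def order_less_le)
  moreover have "(\<lambda>n. ereal ((p n - pb) \<bullet> (a n - ab))) \<longlonglongrightarrow> 0"
    using lim by (simp add: zero_ereal_def)
  ultimately have "\<forall>\<^sub>F n in sequentially. ereal ((p n - pb) \<bullet> (a n - ab)) < \<phi> \<epsilon>"
    by (rule order_tendstoD(2)[rotated])
  then show "\<forall>\<^sub>F n in sequentially. dist (p n) pb < \<epsilon>"
  proof eventually_elim
    case (elim n)
    have "\<phi> (norm (p n - pb)) \<le> ereal ((p n - pb) \<bullet> (a n - ab))"
      using mono a by (auto simp: Gr_def)
    with elim have "\<phi> (norm (p n - pb)) < \<phi> \<epsilon>" by simp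
    then have "norm (p n - pb) < \<epsilon>"
      using mono_onD[OF \<phi>(1), of \<epsilon> "norm (p n - pb)"] \<epsilon> by (auto simp flip: not_le)
    then show ?case by (simp add: dist_norm)
  qed
qed

lemma uniformly_monotone_unique:
  fixes A :: "'a::real_inner \<Rightarrow> 'a set"
  assumes "uniformly_monotone A" "u \<in> A x" "v \<in> A y" "(x - y) \<bullet> (u - v) = 0"
  shows "x = y"
  using uniformly_monotone_convergence[OF assms(1), of "\<lambda>_. u" "\<lambda>_. x" v y] assms(2-4)
  by (simp add: LIMSEQ_const_iff)

lemma banach_fixed_point:
  fixes f :: "'a::{real_normed_vector,banach} \<Rightarrow> 'a"
  assumes "0 \<le> c" "c < 1" "\<And>x y. norm (f x - f y) \<le> c * norm (x - y)"
  obtains x where "f x = x"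
  using banach_fix_type[of c f] assms by (auto simp: dist_norm)

lemma bounded_linear_vec_lambda:
  fixes f :: "'m::finite \<Rightarrow> 'a::real_normed_vector \<Rightarrow> 'b::real_normed_vector"
  assumes f: "\<And>i. bounded_linear (f i)"
  shows "bounded_linear (\<lambda>x. \<chi> i. f i x)"
proof (rule bounded_linear_intro[where K = "\<Sum>i\<in>UNIV. onorm (f i)"])
  note lin = bounded_linear.linear[OF f]
  show "(\<chi> i. f i (x + y)) = (\<chi> i. f i x) + (\<chi> i. f i y)" for x y
    by (simp add: vec_eq_iff linear_add[OF lin])
  show "(\<chi> i. f i (c *\<^sub>R x)) = c *\<^sub>R (\<chi> i. f i x)" for c x
    by (simp add: vec_eq_iff linear_scale[OF lin])
  fix x
  have "norm (\<chi> i. f i x) \<le> (\<Sum>i\<in>UNIV. norm (f i x))"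
    unfolding norm_vec_def by (rule order_trans[OF L2_set_le_sum]) auto
  also have "\<dots> \<le> (\<Sum>i\<in>UNIV. onorm (f i) * norm x)" by (intro sum_mono onorm f)
  finally show "norm (\<chi> i. f i x) \<le> norm x * (\<Sum>i\<in>UNIV. onorm (f i))"
    by (simp add: sum_distrib_left mult.commute)
qed

locale primal_dual_problem =
  fixes A :: "'h::{real_inner, banach} \<Rightarrow> 'h set"
    and z :: 'h
    and G :: "'m::finite \<Rightarrow> 'g::{real_inner, banach} set"
    and r :: "'m \<Rightarrow> 'g"
    and B D :: "'m \<Rightarrow> 'g \<Rightarrow> 'g set"
    and L :: "'m \<Rightarrow> 'h \<Rightarrow> 'g"
    and \<tau> :: real and \<sigma> :: "'m \<Rightarrow> real"
  assumes A: "maximally_monotone_on UNIV A"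
    and G: "\<And>i. subspace (G i)" "\<And>i. closed (G i)"
    and r: "\<And>i. r i \<in> G i"
    and B: "\<And>i. maximally_monotone_on (G i) (B i)"
    and D: "\<And>i. maximally_monotone_on (G i) (D i)"
    and L: "\<And>i. bounded_linear (L i)" "\<And>i. range (L i) \<subseteq> G i"
    and z: "z \<in> range_op (primal_op A B D L r)"
    and \<tau>: "\<tau> > 0"
    and \<sigma>: "\<And>i. \<sigma> i > 0"
    and step_sizes: "\<tau> * (\<Sum>i\<in>UNIV. \<sigma> i * (onorm (L i))\<^sup>2) < 4"
begin

lemma G_arith:
  "x \<in> G i \<Longrightarrow> y \<in> G i \<Longrightarrow> x + y \<in> G i" "x \<in> G i \<Longrightarrow> y \<in> G i \<Longrightarrow> x - y \<in> G i"
  "x \<in> G i \<Longrightarrow> k *\<^sub>R x \<in> G i"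
  using G(1)[of i] by (auto simp: subspace_add subspace_diff subspace_scale)

lemma L_mem: "L i x \<in> G i" using L(2) by auto

lemma L_linear: "L i (x + y) = L i x + L i y" "L i (x - y) = L i x - L i y" "L i (k *\<^sub>R x) = k *\<^sub>R L i x"
  using bounded_linear.linear[OF L(1)[of i]] by (simp_all add: linear_add linear_diff linear_scale)

abbreviation "S \<equiv> product_space G :: ('h \<times> ('g ^ 'm)) set"

text \<open>\<open>Ls\<close> is the adjoint of \<open>x \<mapsto> (L i x)\<^sub>i\<close>, and the vectors \<open>(Ls v, - L i x)\<close> form the skew coupling of
primal and dual variables. Half of the coupling is built into \<open>V\<close>.\<close>

definition Ls :: "'g ^ 'm \<Rightarrow> 'h" where "Ls v = (\<Sum>i\<in>UNIV. adjoint (L i) (v $ i))"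

definition V :: "'h \<times> ('g ^ 'm) \<Rightarrow> 'h \<times> ('g ^ 'm)" where
  "V = (\<lambda>(x, v). ((1 / \<tau>) *\<^sub>R x - (1/2) *\<^sub>R Ls v, \<chi> i. (1 / \<sigma> i) *\<^sub>R v $ i - (1/2) *\<^sub>R L i x))"

definition JA :: "'h \<Rightarrow> 'h" where "JA = resolvent (scale_op \<tau> A)"
definition JB :: "'m \<Rightarrow> 'g \<Rightarrow> 'g" where "JB i = resolvent (scale_op (\<sigma> i) (inverse_op (B i)))"
definition JD :: "'m \<Rightarrow> 'g \<Rightarrow> 'g" where "JD i = resolvent (scale_op (\<sigma> i) (inverse_op (D i)))"

text \<open>\<open>J1 s\<close> and \<open>J2 s\<close> solve for \<open>p\<close> the inclusion between \<open>V (s - p)\<close> and half of the coupling at \<open>p\<close> plus, respectively, the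
operator built from \<open>A\<close> and \<open>B i\<close> and the one built from \<open>D i\<close>. Because of the coupling
part of \<open>V\<close>, the primal component of \<open>p\<close> does not depend on the dual one and is found first.\<close>

definition J1 :: "'h \<times> ('g ^ 'm) \<Rightarrow> 'h \<times> ('g ^ 'm)" where
  "J1 = (\<lambda>(x, v). let p = JA (x - (\<tau> / 2) *\<^sub>R Ls v + \<tau> *\<^sub>R z) in
    (p, \<chi> i. JB i (v $ i + (\<sigma> i / 2) *\<^sub>R L i (2 *\<^sub>R p - x) - \<sigma> i *\<^sub>R r i)))"

definition J2 :: "'h \<times> ('g ^ 'm) \<Rightarrow> 'h \<times> ('g ^ 'm)" where
  "J2 = (\<lambda>(x, v). let p = x - (\<tau> / 2) *\<^sub>R Ls v in
    (p, \<chi> i. JD i (v $ i + (\<sigma> i / 2) *\<^sub>R L i (2 *\<^sub>R p - x))))"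

lemma Ls_bounded_linear: "bounded_linear Ls"
  unfolding Ls_def
  by (intro bounded_linear_sum bounded_linear_compose[OF bounded_linear_adjoint[OF L(1)]]
      bounded_linear_vec_nth)

lemma Ls_linear: "Ls (u + v) = Ls u + Ls v" "Ls (u - v) = Ls u - Ls v" "Ls (k *\<^sub>R v) = k *\<^sub>R Ls v"
  using bounded_linear.linear[OF Ls_bounded_linear] by (simp_all add: linear_add linear_diff linear_scale)

lemma inner_Ls: "x \<bullet> Ls v = (\<Sum>i\<in>UNIV. L i x \<bullet> v $ i)"
  by (simp add: Ls_def inner_sum_right inner_adjoint[OF L(1)])

lemma mem_S: "(x, v) \<in> S \<longleftrightarrow> (\<forall>i. v $ i \<in> G i)"
  by (simp add: product_space_def)

lemma S_subspace: "subspace S"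
  using G(1) by (auto simp: subspace_def product_space_def zero_prod_def)

lemma S_closed: "closed S"
proof -
  have "S = (\<Inter>i. (\<lambda>k. snd k $ i) -` G i)" by (auto simp: product_space_def)
  also have "closed \<dots>"
    by (intro closed_INT ballI continuous_closed_vimage[OF G(2)] continuous_intros)
  finally show ?thesis .
qed

lemma inner_V:
  "(x, v) \<bullet> V (y, q) = x \<bullet> y / \<tau> + (\<Sum>i\<in>UNIV. v $ i \<bullet> q $ i / \<sigma> i)
    - (1/2) * (\<Sum>i\<in>UNIV. L i x \<bullet> q $ i + L i y \<bullet> v $ i)"
  by (simp add: V_def inner_vec_def inner_diff_right inner_Ls sum.distrib sum_subtractf
      sum_divide_distrib inner_commute algebra_simps)

lemma V_symmetric: "s \<bullet> V t = t \<bullet> V s"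
  by (cases s, cases t) (simp add: inner_V inner_commute add.commute)

lemma V_bounded_linear: "bounded_linear V"
proof -
  have "V = (\<lambda>k. ((1 / \<tau>) *\<^sub>R fst k - (1/2) *\<^sub>R Ls (snd k),
      \<chi> i. (1 / \<sigma> i) *\<^sub>R snd k $ i - (1/2) *\<^sub>R L i (fst k)))"
    by (auto simp: V_def)
  moreover have "bounded_linear (\<lambda>k::'h \<times> ('g ^ 'm). \<chi> i. (1 / \<sigma> i) *\<^sub>R snd k $ i - (1/2) *\<^sub>R L i (fst k))"
    by (intro bounded_linear_vec_lambda bounded_linear_sub bounded_linear_snd bounded_linear_fst
        bounded_linear_compose[OF bounded_linear_scaleR_right]
        bounded_linear_compose[OF bounded_linear_vec_nth] bounded_linear_compose[OF L(1)])
  ultimately show ?thesis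
    by (auto intro!: bounded_linear_Pair bounded_linear_sub bounded_linear_fst bounded_linear_snd
      bounded_linear_scaleR_right bounded_linear_compose[OF bounded_linear_scaleR_right]
      bounded_linear_compose[OF Ls_bounded_linear])
qed

lemma V_mem: "s \<in> S \<Longrightarrow> V s \<in> S"
  by (cases s) (auto simp: V_def mem_S intro!: G_arith L_mem)

text \<open>Young's inequality with a free weight \<open>\<theta>\<close>. Coercivity of \<open>V\<close> needs \<open>\<theta> < 1\<close> for the dual part and
\<open>\<tau> * (\<Sum>i\<in>UNIV. \<sigma> i * (onorm (L i))\<^sup>2) / 4 < \<theta>\<close> for the primal part; the step size
condition leaves room for such a \<open>\<theta>\<close>.\<close>

lemma cross_term_bound:
  assumes \<theta>: "0 < \<theta>"
  shows "L i x \<bullet> v \<le> \<theta> * (norm v)\<^sup>2 / \<sigma> i + \<sigma> i * (onorm (L i))\<^sup>2 / (4 * \<theta>) * (norm x)\<^sup>2"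
proof -
  have "L i x \<bullet> v \<le> norm (L i x) * norm v" by (rule norm_cauchy_schwarz)
  also have "\<dots> \<le> onorm (L i) * norm x * norm v" by (intro mult_right_mono onorm L) simp
  also have "\<dots> \<le> \<theta> * (norm v)\<^sup>2 / \<sigma> i + \<sigma> i * (onorm (L i))\<^sup>2 / (4 * \<theta>) * (norm x)\<^sup>2"
  proof -
    have "0 \<le> (2 * \<theta> * norm v - \<sigma> i * onorm (L i) * norm x)\<^sup>2 / (4 * \<theta> * \<sigma> i)"
      using \<theta> \<sigma>[of i] by simp
    also have "\<dots> = \<theta> * (norm v)\<^sup>2 / \<sigma> i + \<sigma> i * (onorm (L i))\<^sup>2 / (4 * \<theta>) * (norm x)\<^sup>2
        - onorm (L i) * norm x * norm v"
      using \<theta> \<sigma>[of i] by (simp add: power2_diff field_simps power2_eq_square)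
    finally show ?thesis by simp
  qed
  finally show ?thesis .
qed

lemma V_coercive: "\<exists>c>0. \<forall>s. c * (norm s)\<^sup>2 \<le> s \<bullet> V s"
proof -
  define N where "N = (\<Sum>i\<in>UNIV. \<sigma> i * (onorm (L i))\<^sup>2)"
  have N: "0 \<le> N" unfolding N_def by (intro sum_nonneg mult_nonneg_nonneg) (auto intro: less_imp_le \<sigma>)
  define t where "t = \<tau> * N / 4"
  define \<theta> where "\<theta> = (1 + t) / 2"
  have "0 \<le> t" "t < 1"
    using step_sizes mult_nonneg_nonneg[OF less_imp_le[OF \<tau>] N] by (simp_all add: t_def N_def)
  then have \<theta>: "0 < \<theta>" "\<theta> < 1" "t < \<theta>" by (simp_all add: \<theta>_def)
  define c1 where "c1 = 1 / \<tau> - N / (4 * \<theta>)"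
  define c2 where "c2 = (1 - \<theta>) / (\<Sum>i\<in>UNIV. \<sigma> i)"
  have "0 < c1" using \<theta> \<tau> by (simp add: c1_def t_def field_simps)
  have \<sigma>_sum: "\<sigma> i \<le> (\<Sum>i\<in>UNIV. \<sigma> i)" for i
    using \<sigma> by (intro member_le_sum) (auto intro: less_imp_le)
  then have \<sigma>_pos: "0 < (\<Sum>i\<in>UNIV. \<sigma> i)" using \<sigma>[of undefined] by (meson less_le_trans)
  then have "0 < c2" using \<theta> by (simp add: c2_def)
  have "min c1 c2 * (norm s)\<^sup>2 \<le> s \<bullet> V s" for s
  proof (cases s)
    case (Pair x v)
    have "(\<Sum>i\<in>UNIV. L i x \<bullet> v $ i)
        \<le> (\<Sum>i\<in>UNIV. \<theta> * (norm (v $ i))\<^sup>2 / \<sigma> i + \<sigma> i * (onorm (L i))\<^sup>2 / (4 * \<theta>) * (norm x)\<^sup>2)"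
      by (intro sum_mono cross_term_bound \<theta>)
    also have "\<dots> = (\<Sum>i\<in>UNIV. \<theta> * (norm (v $ i))\<^sup>2 / \<sigma> i) + N / (4 * \<theta>) * (norm x)\<^sup>2"
      by (simp add: sum.distrib N_def sum_distrib_right sum_divide_distrib)
    finally have cross: "(\<Sum>i\<in>UNIV. L i x \<bullet> v $ i) \<le> \<dots>" .
    have "c2 * (norm v)\<^sup>2 = (\<Sum>i\<in>UNIV. c2 * (norm (v $ i))\<^sup>2)"
      by (simp add: norm_vec_def L2_set_def sum_nonneg sum_distrib_left)
    also have "\<dots> \<le> (\<Sum>i\<in>UNIV. (1 - \<theta>) / \<sigma> i * (norm (v $ i))\<^sup>2)"
      using \<theta> \<sigma> \<sigma>_sum \<sigma>_pos unfolding c2_def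
      by (intro sum_mono mult_right_mono divide_left_mono mult_pos_pos) auto
    also have "\<dots> = (\<Sum>i\<in>UNIV. (norm (v $ i))\<^sup>2 / \<sigma> i) - (\<Sum>i\<in>UNIV. \<theta> * (norm (v $ i))\<^sup>2 / \<sigma> i)"
      by (simp add: diff_divide_distrib left_diff_distrib flip: sum_subtractf)
    finally have v_part: "c2 * (norm v)\<^sup>2 \<le> \<dots>" .
    have "(norm s)\<^sup>2 = (norm x)\<^sup>2 + (norm v)\<^sup>2" by (simp add: Pair norm_Pair)
    then have "min c1 c2 * (norm s)\<^sup>2 = min c1 c2 * (norm x)\<^sup>2 + min c1 c2 * (norm v)\<^sup>2"
      by (simp add: distrib_left)
    also have "\<dots> \<le> c1 * (norm x)\<^sup>2 + c2 * (norm v)\<^sup>2"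
      by (intro add_mono mult_right_mono) auto
    also have "\<dots> \<le> (norm x)\<^sup>2 / \<tau> + (\<Sum>i\<in>UNIV. (norm (v $ i))\<^sup>2 / \<sigma> i) - (\<Sum>i\<in>UNIV. L i x \<bullet> v $ i)"
      using cross v_part by (simp add: c1_def left_diff_distrib)
    also have "\<dots> = s \<bullet> V s"
      by (simp add: Pair inner_V power2_norm_eq_inner sum_distrib_left)
    finally show ?thesis .
  qed
  then show ?thesis using \<open>0 < c1\<close> \<open>0 < c2\<close> by (intro exI[of _ "min c1 c2"]) auto
qed

lemma JA_mem: "(1 / \<tau>) *\<^sub>R (y - JA y) \<in> A (JA y)"
  unfolding JA_def by (rule resolvent_scale_mem[OF A]) (use \<tau> in auto)

lemma JB_mem:
  assumes "y \<in> G i"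
  shows "JB i y \<in> G i" "(1 / \<sigma> i) *\<^sub>R (y - JB i y) \<in> inverse_op (B i) (JB i y)"
  unfolding JB_def using assms \<sigma>
  by (auto intro!: resolvent_scale_mem[OF maximally_monotone_inverse_op[OF B] G] simp del: mem_inverse_op)

lemma JD_mem:
  assumes "y \<in> G i"
  shows "JD i y \<in> G i" "(1 / \<sigma> i) *\<^sub>R (y - JD i y) \<in> inverse_op (D i) (JD i y)"
  unfolding JD_def using assms \<sigma>
  by (auto intro!: resolvent_scale_mem[OF maximally_monotone_inverse_op[OF D] G] simp del: mem_inverse_op)

lemma JA_eqI: "(1 / \<tau>) *\<^sub>R (y - p) \<in> A p \<Longrightarrow> JA y = p"
  unfolding JA_def by (rule resolvent_scale_eqI[OF A subspace_UNIV \<tau>])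

lemma JB_eqI: "(1 / \<sigma> i) *\<^sub>R (y - p) \<in> inverse_op (B i) p \<Longrightarrow> JB i y = p"
  unfolding JB_def by (rule resolvent_scale_eqI[OF maximally_monotone_inverse_op[OF B] G(1) \<sigma>])

lemma JD_eqI: "(1 / \<sigma> i) *\<^sub>R (y - p) \<in> inverse_op (D i) p \<Longrightarrow> JD i y = p"
  unfolding JD_def by (rule resolvent_scale_eqI[OF maximally_monotone_inverse_op[OF D] G(1) \<sigma>])

text \<open>For \<open>p = J1 s\<close> or \<open>p = J2 s\<close>, the pair \<open>(uA s p, uB s p)\<close> is \<open>V (s - p)\<close> without half of the skew
coupling at \<open>p\<close>. It is the part of \<open>V (s - p)\<close> that lies in the values of the monotone operators, up to the
constants \<open>z\<close> and \<open>r i\<close>.\<close>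

definition uA :: "'h \<times> ('g ^ 'm) \<Rightarrow> 'h \<times> ('g ^ 'm) \<Rightarrow> 'h" where
  "uA = (\<lambda>(x, v) (p, q). (1 / \<tau>) *\<^sub>R (x - p) - (1/2) *\<^sub>R Ls v)"

definition uB :: "'h \<times> ('g ^ 'm) \<Rightarrow> 'h \<times> ('g ^ 'm) \<Rightarrow> 'm \<Rightarrow> 'g" where
  "uB = (\<lambda>(x, v) (p, q) i. (1 / \<sigma> i) *\<^sub>R (v $ i - q $ i) + (1/2) *\<^sub>R L i (2 *\<^sub>R p - x))"

lemma J1_inclusions:
  assumes s: "s \<in> S"
  shows "J1 s \<in> S" "uA s (J1 s) + z \<in> A (fst (J1 s))"
    "uB s (J1 s) i - r i \<in> inverse_op (B i) (snd (J1 s) $ i)"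
proof -
  obtain x v where xv: "s = (x, v)" by (cases s)
  have v: "v $ i \<in> G i" for i using s by (simp add: xv mem_S)
  define p where "p = JA (x - (\<tau> / 2) *\<^sub>R Ls v + \<tau> *\<^sub>R z)"
  define y where "y = (\<lambda>i. v $ i + (\<sigma> i / 2) *\<^sub>R L i (2 *\<^sub>R p - x) - \<sigma> i *\<^sub>R r i)"
  have y: "y i \<in> G i" for i unfolding y_def by (intro G_arith v L_mem r)
  have J: "J1 (x, v) = (p, \<chi> i. JB i (y i))" by (simp add: J1_def p_def y_def Let_def)
  show "J1 s \<in> S" using JB_mem(1)[OF y] by (simp add: xv J mem_S)
  have "(1 / \<tau>) *\<^sub>R (x - (\<tau> / 2) *\<^sub>R Ls v + \<tau> *\<^sub>R z - p) = uA s (J1 s) + z"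
    using \<tau> by (simp add: uA_def J xv algebra_simps)
  then show "uA s (J1 s) + z \<in> A (fst (J1 s))"
    using JA_mem[of "x - (\<tau> / 2) *\<^sub>R Ls v + \<tau> *\<^sub>R z"] by (simp add: xv J p_def)
  have "(1 / \<sigma> i) *\<^sub>R (y i - JB i (y i)) = uB s (J1 s) i - r i"
    using \<sigma>[of i] by (simp add: uB_def J xv y_def algebra_simps)
  then show "uB s (J1 s) i - r i \<in> inverse_op (B i) (snd (J1 s) $ i)"
    using JB_mem(2)[OF y, of i] by (simp add: xv J)
qed

lemma J2_inclusions:
  assumes s: "s \<in> S"
  shows "J2 s \<in> S" "uA s (J2 s) = 0"
    "uB s (J2 s) i \<in> inverse_op (D i) (snd (J2 s) $ i)"
proof -
  obtain x v where xv: "s = (x, v)" by (cases s)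
  have v: "v $ i \<in> G i" for i using s by (simp add: xv mem_S)
  define p where "p = x - (\<tau> / 2) *\<^sub>R Ls v"
  define y where "y = (\<lambda>i. v $ i + (\<sigma> i / 2) *\<^sub>R L i (2 *\<^sub>R p - x))"
  have y: "y i \<in> G i" for i unfolding y_def by (intro G_arith v L_mem)
  have J: "J2 (x, v) = (p, \<chi> i. JD i (y i))" by (simp add: J2_def p_def y_def Let_def)
  show "J2 s \<in> S" using JD_mem(1)[OF y] by (simp add: xv J mem_S)
  show "uA s (J2 s) = 0" using \<tau> by (simp add: uA_def J xv p_def)
  have "(1 / \<sigma> i) *\<^sub>R (y i - JD i (y i)) = uB s (J2 s) i"
    using \<sigma>[of i] by (simp add: uB_def J xv y_def algebra_simps)
  then show "uB s (J2 s) i \<in> inverse_op (D i) (snd (J2 s) $ i)"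
    using JD_mem(2)[OF y, of i] by (simp add: xv J)
qed

text \<open>The coupling contributes \<open>\<langle>e1, Ls e2\<rangle>/2 - (\<Sum>i\<in>UNIV. \<langle>L i e1, e2 $ i\<rangle>)/2 = 0\<close> to the left-hand side, where
\<open>(e1, e2) = p - p'\<close>. Both firm nonexpansiveness and the strong convergence result reduce to this
identity.\<close>

lemma skew_part_cancels:
  "(p - p') \<bullet> V ((s - s') - (p - p')) =
    (fst p - fst p') \<bullet> (uA s p - uA s' p')
    + (\<Sum>i\<in>UNIV. (snd p $ i - snd p' $ i) \<bullet> (uB s p i - uB s' p' i))"
proof -
  define e1 e2 h1 h2 where
    eh: "e1 = fst p - fst p'" "e2 = snd p - snd p'" "h1 = fst s - fst s'" "h2 = snd s - snd s'"
  have a: "uA s p - uA s' p' = (1 / \<tau>) *\<^sub>R (h1 - e1) - (1/2) *\<^sub>R Ls h2"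
    by (simp add: uA_def eh case_prod_beta Ls_linear algebra_simps)
  have b: "uB s p i - uB s' p' i = (1 / \<sigma> i) *\<^sub>R (h2 $ i - e2 $ i) + (1/2) *\<^sub>R L i (2 *\<^sub>R e1 - h1)" for i
    by (simp add: uB_def eh case_prod_beta L_linear algebra_simps)
  have e: "p - p' = (e1, e2)" "s - s' - (p - p') = (h1 - e1, h2 - e2)"
    by (simp_all add: eh prod_eq_iff)
  have "(\<Sum>i\<in>UNIV. e2 $ i \<bullet> (h2 - e2) $ i / \<sigma> i)
      - (1/2) * (\<Sum>i\<in>UNIV. L i e1 \<bullet> (h2 - e2) $ i + L i (h1 - e1) \<bullet> e2 $ i)
    = - (1/2) * (\<Sum>i\<in>UNIV. L i e1 \<bullet> h2 $ i)
      + (\<Sum>i\<in>UNIV. e2 $ i \<bullet> ((1 / \<sigma> i) *\<^sub>R (h2 $ i - e2 $ i) + (1/2) *\<^sub>R L i (2 *\<^sub>R e1 - h1)))"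
    unfolding sum_distrib_left sum_subtractf[symmetric] sum.distrib[symmetric]
    by (rule sum.cong)
      (simp_all add: L_linear inner_add_right inner_diff_right inner_diff_left inner_commute
        algebra_simps diff_divide_distrib add_divide_distrib)
  then have "(e1, e2) \<bullet> V (h1 - e1, h2 - e2) = e1 \<bullet> ((1 / \<tau>) *\<^sub>R (h1 - e1) - (1/2) *\<^sub>R Ls h2)
    + (\<Sum>i\<in>UNIV. e2 $ i \<bullet> ((1 / \<sigma> i) *\<^sub>R (h2 $ i - e2 $ i) + (1/2) *\<^sub>R L i (2 *\<^sub>R e1 - h1)))"
    unfolding inner_V by (simp add: inner_diff_right inner_Ls)
  then show ?thesis unfolding e(2) unfolding e(1) a b by (simp add: eh)
qed

lemma inverse_B_mono: "u \<in> inverse_op (B i) x \<Longrightarrow> v \<in> inverse_op (B i) y \<Longrightarrow> 0 \<le> (x - y) \<bullet> (u - v)"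
  by (rule maximally_monotone_onD(3)[OF maximally_monotone_inverse_op[OF B]])

lemma inverse_D_mono: "u \<in> inverse_op (D i) x \<Longrightarrow> v \<in> inverse_op (D i) y \<Longrightarrow> 0 \<le> (x - y) \<bullet> (u - v)"
  by (rule maximally_monotone_onD(3)[OF maximally_monotone_inverse_op[OF D]])

lemma J1_terms_nonneg:
  assumes "s \<in> S" "s' \<in> S"
  shows "0 \<le> (fst (J1 s) - fst (J1 s')) \<bullet> (uA s (J1 s) - uA s' (J1 s'))"
    "0 \<le> (snd (J1 s) $ i - snd (J1 s') $ i) \<bullet> (uB s (J1 s) i - uB s' (J1 s') i)"
  using maximally_monotone_onD(3)[OF A J1_inclusions(2)[OF assms(1)] J1_inclusions(2)[OF assms(2)]]
    inverse_B_mono[OF J1_inclusions(3)[OF assms(1)] J1_inclusions(3)[OF assms(2)]]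
  by simp_all

lemma J1_firmly_nonexpansive:
  assumes "s \<in> S" "s' \<in> S"
  shows "0 \<le> (J1 s - J1 s') \<bullet> V ((s - s') - (J1 s - J1 s'))"
  unfolding skew_part_cancels by (intro add_nonneg_nonneg sum_nonneg J1_terms_nonneg assms)

lemma J2_firmly_nonexpansive:
  assumes "s \<in> S" "s' \<in> S"
  shows "0 \<le> (J2 s - J2 s') \<bullet> V ((s - s') - (J2 s - J2 s'))"
  unfolding skew_part_cancels J2_inclusions(2)[OF assms(1)] J2_inclusions(2)[OF assms(2)]
  using inverse_D_mono[OF J2_inclusions(3)[OF assms(1)] J2_inclusions(3)[OF assms(2)]]
  by (intro add_nonneg_nonneg sum_nonneg) auto

lemma parallel_sum_iff:
  "v \<in> parallel_sum (B i) (D i) y \<longleftrightarrow>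
    (\<exists>b d. b \<in> inverse_op (B i) v \<and> d \<in> inverse_op (D i) v \<and> y = b + d)"
  by (auto simp: parallel_sum_def set_plus_def simp del: mem_inverse_op) (auto simp: inverse_op_def Gr_def set_plus_def)

text \<open>At a fixed point the inclusions for \<open>J1\<close> and \<open>J2\<close> hold at the same \<open>p\<close> with opposite left-hand sides
\<open>V (s - p)\<close> and \<open>V (p - s)\<close>. Adding them leaves the full coupling, which is the primal-dual system.\<close>

lemma fixed_point_solution:
  assumes s: "s \<in> S" and fixp: "J2 (2 *\<^sub>R J1 s - s) = J1 s"
  shows "primal_dual_solution A B D L r z (J1 s)"
proof -
  obtain x v where xv: "s = (x, v)" by (cases s)
  obtain p q where pq: "J1 (x, v) = (p, q)" by (cases "J1 (x, v)")
  have s': "2 *\<^sub>R J1 s - s \<in> S"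
    using s J1_inclusions(1)[OF s] S_subspace by (simp add: subspace_diff subspace_scale)
  have sum_A: "uA s (J1 s) + uA (2 *\<^sub>R J1 s - s) (J1 s) = - Ls q"
  proof -
    have "(2 / \<tau>) *\<^sub>R p = (1 / \<tau>) *\<^sub>R p + (1 / \<tau>) *\<^sub>R p" by (simp flip: scaleR_left_distrib)
    then show ?thesis by (simp add: uA_def xv pq Ls_linear algebra_simps)
  qed
  have sum_B: "uB s (J1 s) i + uB (2 *\<^sub>R J1 s - s) (J1 s) i = L i p" for i
  proof -
    have "(2 / \<sigma> i) *\<^sub>R q $ i = (1 / \<sigma> i) *\<^sub>R q $ i + (1 / \<sigma> i) *\<^sub>R q $ i"
      by (simp flip: scaleR_left_distrib)
    then show ?thesis by (simp add: uB_def xv pq L_linear algebra_simps)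
  qed
  have "z - Ls q \<in> A p"
    using J1_inclusions(2)[OF s] J2_inclusions(2)[OF s'] sum_A by (simp add: fixp) (simp add: xv pq algebra_simps)
  moreover have "q $ i \<in> parallel_sum (B i) (D i) (L i p - r i)" for i
  proof -
    have "L i p - r i = (uB s (J1 s) i - r i) + uB (2 *\<^sub>R J1 s - s) (J1 s) i"
      by (simp flip: sum_B)
    moreover have "uB s (J1 s) i - r i \<in> inverse_op (B i) (q $ i)"
      using J1_inclusions(3)[OF s, of i] by (simp add: xv pq)
    moreover have "uB (2 *\<^sub>R J1 s - s) (J1 s) i \<in> inverse_op (D i) (q $ i)"
      using J2_inclusions(3)[OF s', of i] unfolding fixp by (simp add: xv pq)
    ultimately show ?thesis unfolding parallel_sum_iff by blast
  qed
  ultimately show ?thesis by (simp add: primal_dual_solution_def xv pq Ls_def)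
qed

text \<open>A primal-dual solution \<open>(p, q)\<close> comes from a fixed point \<open>s = (x, v)\<close> if \<open>V (s - (p, q))\<close> equals a prescribed
vector. Eliminating \<open>v\<close> turns this into a fixed point equation for \<open>x\<close> with Lipschitz constant
\<open>\<tau> * (\<Sum>i\<in>UNIV. \<sigma> i * (onorm (L i))\<^sup>2) / 4 < 1\<close>, so Banach's theorem applies.\<close>

lemma fixed_point_exists: "\<exists>s\<in>S. J2 (2 *\<^sub>R J1 s - s) = J1 s"
proof -
  obtain p where "z \<in> primal_op A B D L r p" using z by (auto simp: range_op_def)
  then obtain a t where a: "a \<in> A p" and z_eq: "z = a + t"
    and "t \<in> (\<Sum>i\<in>UNIV. adjoint (L i) ` parallel_sum (B i) (D i) (L i p - r i))"
    unfolding primal_op_def by (auto elim: set_plus_elim)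
  then obtain f where f: "t = sum f UNIV" "\<And>i. f i \<in> adjoint (L i) ` parallel_sum (B i) (D i) (L i p - r i)"
    by (auto simp: set_sum_alt)
  then have "\<exists>q b d. f i = adjoint (L i) q \<and> b \<in> inverse_op (B i) q \<and> d \<in> inverse_op (D i) q \<and>
      L i p - r i = b + d" for i
    using f(2)[of i] unfolding image_iff Bex_def parallel_sum_iff by metis
  then obtain q' b d where q': "\<And>i. f i = adjoint (L i) (q' i)"
    and b: "\<And>i. b i \<in> inverse_op (B i) (q' i)" and d: "\<And>i. d i \<in> inverse_op (D i) (q' i)"
    and bd: "\<And>i. L i p - r i = b i + d i"
    by metis
  define q where "q = (\<chi> i. q' i)"
  have zA: "z - Ls q \<in> A p" using a by (simp add: z_eq f(1) q' Ls_def q_def)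
  define \<Psi> where "\<Psi> = (\<lambda>X. \<chi> i. q $ i - \<sigma> i *\<^sub>R d i + (\<sigma> i / 2) *\<^sub>R L i X)"
  define \<Phi> where "\<Phi> = (\<lambda>X. p - \<tau> *\<^sub>R Ls q + (\<tau> / 2) *\<^sub>R Ls (\<Psi> X))"
  define N where "N = (\<Sum>i\<in>UNIV. \<sigma> i * (onorm (L i))\<^sup>2)"
  have N: "0 \<le> N" unfolding N_def by (intro sum_nonneg mult_nonneg_nonneg) (auto intro: less_imp_le \<sigma>)
  have "norm (\<Phi> X - \<Phi> Y) \<le> \<tau> * N / 4 * norm (X - Y)" for X Y
  proof -
    have "norm (Ls (\<chi> i. \<sigma> i *\<^sub>R L i h)) \<le> N * norm h" for h
    proof (cases "Ls (\<chi> i. \<sigma> i *\<^sub>R L i h) = 0")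
      case False
      let ?g = "Ls (\<chi> i. \<sigma> i *\<^sub>R L i h)"
      have "norm ?g * norm ?g = (\<Sum>i\<in>UNIV. \<sigma> i * (L i ?g \<bullet> L i h))"
        by (simp add: inner_Ls flip: power2_eq_square power2_norm_eq_inner)
          (simp add: inner_Ls power2_norm_eq_inner)
      also have "\<dots> \<le> (\<Sum>i\<in>UNIV. \<sigma> i * ((onorm (L i) * norm ?g) * (onorm (L i) * norm h)))"
        by (intro sum_mono mult_left_mono order_trans[OF norm_cauchy_schwarz] mult_mono onorm L
            mult_nonneg_nonneg onorm_pos_le less_imp_le[OF \<sigma>]) auto
      also have "\<dots> = norm ?g * (N * norm h)"
        by (simp add: N_def sum_distrib_left sum_distrib_right power2_eq_square mult_ac)
      finally show ?thesis using False by simp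
    qed (use N in simp)
    moreover have "\<Phi> X - \<Phi> Y = (\<tau> / 4) *\<^sub>R Ls (\<chi> i. \<sigma> i *\<^sub>R L i (X - Y))"
    proof -
      have "\<Psi> X - \<Psi> Y = (1/2) *\<^sub>R (\<chi> i. \<sigma> i *\<^sub>R L i (X - Y))"
        by (simp add: \<Psi>_def vec_eq_iff L_linear algebra_simps)
      then show ?thesis by (simp add: \<Phi>_def Ls_linear flip: scaleR_diff_right Ls_linear(2))
    qed
    ultimately show ?thesis using \<tau> by (simp add: mult_left_mono)
  qed
  moreover have "\<tau> * N / 4 < 1" using step_sizes by (simp add: N_def)
  ultimately obtain x where x: "\<Phi> x = x"
    using banach_fixed_point[of "\<tau> * N / 4" \<Phi>] \<tau> N by auto
  define v where "v = \<Psi> x"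
  define s where "s = (x, v)"
  have mem: "q' i \<in> G i" "d i \<in> G i" for i
    using maximally_monotone_onD(1,2)[OF maximally_monotone_inverse_op[OF D] d[of i]] by auto
  have s: "s \<in> S"
    by (auto simp: s_def v_def \<Psi>_def q_def mem_S intro!: G_arith L_mem mem)
  have x_eq: "x = p - \<tau> *\<^sub>R Ls q + (\<tau> / 2) *\<^sub>R Ls v" using x by (simp add: \<Phi>_def v_def)
  have "JA (x - (\<tau> / 2) *\<^sub>R Ls v + \<tau> *\<^sub>R z) = p"
  proof (rule JA_eqI)
    have "x - (\<tau> / 2) *\<^sub>R Ls v + \<tau> *\<^sub>R z - p = \<tau> *\<^sub>R (z - Ls q)"
      by (subst x_eq) (simp add: algebra_simps)
    then show "(1 / \<tau>) *\<^sub>R (x - (\<tau> / 2) *\<^sub>R Ls v + \<tau> *\<^sub>R z - p) \<in> A p" using zA \<tau> by simp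
  qed
  moreover have "JB i (v $ i + (\<sigma> i / 2) *\<^sub>R L i (2 *\<^sub>R p - x) - \<sigma> i *\<^sub>R r i) = q $ i" for i
  proof (rule JB_eqI)
    have b_eq: "b i = L i p - r i - d i" using bd[of i] by (simp add: algebra_simps)
    have "v $ i + (\<sigma> i / 2) *\<^sub>R L i (2 *\<^sub>R p - x) - \<sigma> i *\<^sub>R r i - q $ i = \<sigma> i *\<^sub>R b i"
      by (simp add: b_eq v_def \<Psi>_def L_linear algebra_simps)
    then show "(1 / \<sigma> i) *\<^sub>R (v $ i + (\<sigma> i / 2) *\<^sub>R L i (2 *\<^sub>R p - x) - \<sigma> i *\<^sub>R r i - q $ i)
        \<in> inverse_op (B i) (q $ i)"
      using b[of i] \<sigma>[of i] by (simp add: q_def)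
  qed
  ultimately have J1_s: "J1 s = (p, q)" by (simp add: J1_def s_def vec_eq_iff)
  define x' v' where "x' = 2 *\<^sub>R p - x" "v' = 2 *\<^sub>R q - v"
  have s'_eq: "2 *\<^sub>R J1 s - s = (x', v')" unfolding J1_s by (simp add: s_def x'_v'_def)
  have p_eq: "x' - (\<tau> / 2) *\<^sub>R Ls v' = p"
  proof -
    have "x' - (\<tau> / 2) *\<^sub>R Ls v' = 2 *\<^sub>R p - (x + \<tau> *\<^sub>R Ls q - (\<tau> / 2) *\<^sub>R Ls v)"
      by (simp add: x'_v'_def Ls_linear algebra_simps)
    also have "x + \<tau> *\<^sub>R Ls q - (\<tau> / 2) *\<^sub>R Ls v = p" by (subst x_eq) simp
    finally show ?thesis by (simp add: scaleR_2)
  qed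
  have "JD i (v' $ i + (\<sigma> i / 2) *\<^sub>R L i (2 *\<^sub>R p - x')) = q $ i" for i
  proof (rule JD_eqI)
    have "v' $ i + (\<sigma> i / 2) *\<^sub>R L i (2 *\<^sub>R p - x') - q $ i = \<sigma> i *\<^sub>R d i"
      by (simp add: x'_v'_def v_def \<Psi>_def L_linear algebra_simps scaleR_2)
    then show "(1 / \<sigma> i) *\<^sub>R (v' $ i + (\<sigma> i / 2) *\<^sub>R L i (2 *\<^sub>R p - x') - q $ i) \<in> inverse_op (D i) (q $ i)"
      using d[of i] \<sigma>[of i] by (simp add: q_def)
  qed
  then have "J2 (2 *\<^sub>R J1 s - s) = (p, q)"
    unfolding s'_eq by (simp add: J2_def p_eq vec_eq_iff)
  with J1_s s show ?thesis by metis
qed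

text \<open>The three monotonicity gaps between two solutions, those of \<open>A\<close>, of the inverses of \<open>B i\<close> and of the
inverses of \<open>D i\<close>, are nonnegative and add up to zero.\<close>

lemma uniformly_monotone_solution_unique:
  assumes um: "uniformly_monotone A" "\<And>i. uniformly_monotone (inverse_op (B i))"
    and s: "primal_dual_solution A B D L r z s" and s': "primal_dual_solution A B D L r z s'"
  shows "s = s'"
proof -
  obtain x v x' v' where eq: "s = (x, v)" "s' = (x', v')" by (cases s, cases s')
  have a: "z - Ls v \<in> A x" "z - Ls v' \<in> A x'"
    using s s' by (simp_all add: eq primal_dual_solution_def Ls_def)
  have "\<forall>i. \<exists>b d. b \<in> inverse_op (B i) (v $ i) \<and> d \<in> inverse_op (D i) (v $ i) \<and> L i x - r i = b + d"
    "\<forall>i. \<exists>b d. b \<in> inverse_op (B i) (v' $ i) \<and> d \<in> inverse_op (D i) (v' $ i) \<and> L i x' - r i = b + d"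
    using s s' unfolding eq primal_dual_solution_def parallel_sum_iff by auto
  then obtain b d b' d' where
    b: "\<And>i. b i \<in> inverse_op (B i) (v $ i)" "\<And>i. b' i \<in> inverse_op (B i) (v' $ i)" and
    d: "\<And>i. d i \<in> inverse_op (D i) (v $ i)" "\<And>i. d' i \<in> inverse_op (D i) (v' $ i)" and
    bd: "\<And>i. L i x - r i = b i + d i" "\<And>i. L i x' - r i = b' i + d' i"
    by metis
  have A_nn: "0 \<le> (x - x') \<bullet> ((z - Ls v) - (z - Ls v'))"
    by (rule maximally_monotone_onD(3)[OF A a])
  have B_nn: "0 \<le> (v $ i - v' $ i) \<bullet> (b i - b' i)" for i by (rule inverse_B_mono[OF b])
  have D_nn: "0 \<le> (v $ i - v' $ i) \<bullet> (d i - d' i)" for i by (rule inverse_D_mono[OF d])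
  have "(x - x') \<bullet> ((z - Ls v) - (z - Ls v')) = - ((x - x') \<bullet> Ls (v - v'))"
    by (simp add: Ls_linear inner_diff_right)
  also have "\<dots> = - (\<Sum>i\<in>UNIV. (v $ i - v' $ i) \<bullet> (b i - b' i) + (v $ i - v' $ i) \<bullet> (d i - d' i))"
  proof -
    have "L i (x - x') = (b i - b' i) + (d i - d' i)" for i
      using bd[of i] by (simp add: L_linear algebra_simps)
    then have "(x - x') \<bullet> Ls (v - v') = (\<Sum>i\<in>UNIV. (v $ i - v' $ i) \<bullet> ((b i - b' i) + (d i - d' i)))"
      by (simp add: inner_Ls inner_commute)
    then show ?thesis by (simp only: inner_add_right)
  qed
  finally have total: "(x - x') \<bullet> ((z - Ls v) - (z - Ls v'))
    + (\<Sum>i\<in>UNIV. (v $ i - v' $ i) \<bullet> (b i - b' i) + (v $ i - v' $ i) \<bullet> (d i - d' i)) = 0" by simp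
  have nn: "0 \<le> (\<Sum>i\<in>UNIV. (v $ i - v' $ i) \<bullet> (b i - b' i) + (v $ i - v' $ i) \<bullet> (d i - d' i))"
    by (intro sum_nonneg add_nonneg_nonneg B_nn D_nn)
  with total A_nn have "(x - x') \<bullet> ((z - Ls v) - (z - Ls v')) = 0" by linarith
  then have "x = x'" by (rule uniformly_monotone_unique[OF um(1) a])
  moreover have "v $ i = v' $ i" for i
  proof -
    have "(\<Sum>i\<in>UNIV. (v $ i - v' $ i) \<bullet> (b i - b' i) + (v $ i - v' $ i) \<bullet> (d i - d' i)) = 0"
      using total A_nn nn by linarith
    then have "(v $ i - v' $ i) \<bullet> (b i - b' i) + (v $ i - v' $ i) \<bullet> (d i - d' i) = 0"
      by (subst (asm) sum_nonneg_eq_0_iff) (auto intro: add_nonneg_nonneg B_nn D_nn)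
    then have "(v $ i - v' $ i) \<bullet> (b i - b' i) = 0" using B_nn[of i] D_nn[of i] by linarith
    then show ?thesis by (rule uniformly_monotone_unique[OF um(2) b])
  qed
  ultimately show ?thesis by (simp add: eq vec_eq_iff)
qed

text \<open>By \<open>skew_part_cancels\<close> the hypothesis controls a sum of nonnegative gaps, one for \<open>A\<close> and one for each
inverse of \<open>B i\<close>, so each gap tends to zero.\<close>

lemma uniformly_monotone_J1_convergence:
  assumes um: "uniformly_monotone A" "\<And>i. uniformly_monotone (inverse_op (B i))"
    and s: "\<And>n. s n \<in> S" "sb \<in> S"
    and lim: "(\<lambda>n. (J1 (s n) - J1 sb) \<bullet> V ((s n - sb) - (J1 (s n) - J1 sb))) \<longlonglongrightarrow> 0"
  shows "(\<lambda>n. J1 (s n)) \<longlonglongrightarrow> J1 sb"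
proof -
  define fA where "fA = (\<lambda>n. (fst (J1 (s n)) - fst (J1 sb)) \<bullet> (uA (s n) (J1 (s n)) - uA sb (J1 sb)))"
  define fB where "fB = (\<lambda>i n. (snd (J1 (s n)) $ i - snd (J1 sb) $ i) \<bullet> (uB (s n) (J1 (s n)) i - uB sb (J1 sb) i))"
  have nn: "0 \<le> fA n" "0 \<le> fB i n" for i n
    unfolding fA_def fB_def by (intro J1_terms_nonneg s)+
  have lim': "(\<lambda>n. fA n + (\<Sum>i\<in>UNIV. fB i n)) \<longlonglongrightarrow> 0"
    using lim unfolding skew_part_cancels fA_def fB_def .
  have squeeze: "f \<longlonglongrightarrow> 0"
    if "\<And>n. 0 \<le> f n" "\<And>n. f n \<le> fA n + (\<Sum>i\<in>UNIV. fB i n)" for f :: "nat \<Rightarrow> real"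
    by (rule tendsto_sandwich[OF _ _ tendsto_const lim']) (use that in auto)
  have "(\<lambda>n. fst (J1 (s n))) \<longlonglongrightarrow> fst (J1 sb)"
  proof (rule uniformly_monotone_convergence[OF um(1)])
    show "uA (s n) (J1 (s n)) + z \<in> A (fst (J1 (s n)))" "uA sb (J1 sb) + z \<in> A (fst (J1 sb))" for n
      by (intro J1_inclusions s)+
    have "fA \<longlonglongrightarrow> 0" by (rule squeeze) (auto intro: nn sum_nonneg)
    then show "(\<lambda>n. (fst (J1 (s n)) - fst (J1 sb)) \<bullet> (uA (s n) (J1 (s n)) + z - (uA sb (J1 sb) + z))) \<longlonglongrightarrow> 0"
      by (simp add: fA_def)
  qed
  moreover have "(\<lambda>n. snd (J1 (s n))) \<longlonglongrightarrow> snd (J1 sb)"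
  proof (rule vec_tendstoI, rule uniformly_monotone_convergence[OF um(2)])
    fix i
    show "uB (s n) (J1 (s n)) i - r i \<in> inverse_op (B i) (snd (J1 (s n)) $ i)"
      "uB sb (J1 sb) i - r i \<in> inverse_op (B i) (snd (J1 sb) $ i)" for n
      by (intro J1_inclusions s)+
    have "fB i n \<le> fA n + (\<Sum>i\<in>UNIV. fB i n)" for n
      using member_le_sum[of i UNIV "\<lambda>i. fB i n"] nn(1)[of n] nn(2)[of _ n] by force
    then have "fB i \<longlonglongrightarrow> 0" by (intro squeeze nn)
    then show "(\<lambda>n. (snd (J1 (s n)) $ i - snd (J1 sb) $ i)
        \<bullet> (uB (s n) (J1 (s n)) i - r i - (uB sb (J1 sb) i - r i))) \<longlonglongrightarrow> 0"
      by (simp add: fB_def)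
  qed
  ultimately have "(\<lambda>n. (fst (J1 (s n)), snd (J1 (s n)))) \<longlonglongrightarrow> (fst (J1 sb), snd (J1 sb))"
    by (rule tendsto_Pair)
  then show ?thesis by simp
qed

lemma J1_J2_pair: "\<exists>c. firmly_nonexpansive_pair S V J1 J2 c"
proof -
  obtain c where c: "c > 0" "\<And>s. c * (norm s)\<^sup>2 \<le> s \<bullet> V s" using V_coercive by blast
  have "firmly_nonexpansive_pair S V J1 J2 c"
    by (rule firmly_nonexpansive_pair.intro)
      (fact S_subspace S_closed V_bounded_linear V_symmetric V_mem c J1_inclusions(1) J2_inclusions(1)
        J1_firmly_nonexpansive J2_firmly_nonexpansive)+
  then show ?thesis by blast
qed

end

section \<open>Convergence of the primal-dual algorithm\<close>

theorem theorem13: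
  fixes A :: "'h::{real_inner, banach} \<Rightarrow> 'h set"
    and z :: 'h
    and G :: "'m::finite \<Rightarrow> 'g::{real_inner, banach} set"
    and r :: "'m \<Rightarrow> 'g"
    and B D :: "'m \<Rightarrow> 'g \<Rightarrow> 'g set"
    and L :: "'m \<Rightarrow> 'h \<Rightarrow> 'g"
    and \<tau> \<alpha> lam \<sigma> \<delta> :: real
    and \<sigma>' :: "'m \<Rightarrow> real"
    and \<alpha>' lam' :: "nat \<Rightarrow> real"
    and x p1 w1 z1 :: "nat \<Rightarrow> 'h"
    and v p2 w2 z2 :: "nat \<Rightarrow> 'g ^ 'm"
  assumes A: "maximally_monotone_on UNIV A"
    and G: "\<And>i. subspace (G i)" "\<And>i. closed (G i)"
    and r: "\<And>i. r i \<in> G i"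
    and B: "\<And>i. maximally_monotone_on (G i) (B i)"
    and D: "\<And>i. maximally_monotone_on (G i) (D i)"
    and L: "\<And>i. bounded_linear (L i)" "\<And>i. range (L i) \<subseteq> G i" "\<And>i. L i \<noteq> (\<lambda>_. 0)"
    and z: "z \<in> range_op (primal_op A B D L r)"
    and v_init: "\<And>i. v 0 $ i \<in> G i" "\<And>i. v 1 $ i \<in> G i"
    and \<tau>: "\<tau> > 0"
    and \<sigma>': "\<And>i. \<sigma>' i > 0"
    and \<tau>_\<sigma>': "\<tau> * (\<Sum>i\<in>UNIV. \<sigma>' i * (onorm (L i))\<^sup>2) < 4"
    and \<alpha>'_mono: "mono_on {1..} \<alpha>'"
    and \<alpha>'_1: "\<alpha>' 1 = 0"
    and \<alpha>'_bounds: "\<And>n. n \<ge> 1 \<Longrightarrow> 0 \<le> \<alpha>' n \<and> \<alpha>' n \<le> \<alpha>"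
    and \<alpha>: "\<alpha> < 1"
    and pos: "lam > 0" "\<sigma> > 0" "\<delta> > 0"
    and \<delta>: "\<delta> > (\<alpha>\<^sup>2 * (1 + \<alpha>) + \<alpha> * \<sigma>) / (1 - \<alpha>\<^sup>2)"
    and lam': "\<And>n. n \<ge> 1 \<Longrightarrow> lam \<le> lam' n \<and>
      lam' n \<le> 2 * ((\<delta> - \<alpha> * (\<alpha> * (1 + \<alpha>) + \<alpha> * \<delta> + \<sigma>)) /
                     (\<delta> * (1 + \<alpha> * (1 + \<alpha>) + \<alpha> * \<delta> + \<sigma>)))"
    and p1: "\<And>n. n \<ge> 1 \<Longrightarrow> p1 n = resolvent (scale_op \<tau> A)
      (x n + \<alpha>' n *\<^sub>R (x n - x (n - 1))
       - (\<tau> / 2) *\<^sub>R (\<Sum>i\<in>UNIV. adjoint (L i) (v n $ i + \<alpha>' n *\<^sub>R (v n $ i - v (n - 1) $ i)))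
       + \<tau> *\<^sub>R z)"
    and w1: "\<And>n. n \<ge> 1 \<Longrightarrow> w1 n = 2 *\<^sub>R p1 n - x n - \<alpha>' n *\<^sub>R (x n - x (n - 1))"
    and p2: "\<And>n i. n \<ge> 1 \<Longrightarrow> p2 n $ i = resolvent (scale_op (\<sigma>' i) (inverse_op (B i)))
      (v n $ i + \<alpha>' n *\<^sub>R (v n $ i - v (n - 1) $ i)
       + (\<sigma>' i / 2) *\<^sub>R L i (w1 n) - \<sigma>' i *\<^sub>R r i)"
    and w2: "\<And>n i. n \<ge> 1 \<Longrightarrow>
      w2 n $ i = 2 *\<^sub>R p2 n $ i - v n $ i - \<alpha>' n *\<^sub>R (v n $ i - v (n - 1) $ i)"
    and z1: "\<And>n. n \<ge> 1 \<Longrightarrow>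
      z1 n = w1 n - (\<tau> / 2) *\<^sub>R (\<Sum>i\<in>UNIV. adjoint (L i) (w2 n $ i))"
    and x: "\<And>n. n \<ge> 1 \<Longrightarrow>
      x (n + 1) = x n + \<alpha>' n *\<^sub>R (x n - x (n - 1)) + lam' n *\<^sub>R (z1 n - p1 n)"
    and z2: "\<And>n i. n \<ge> 1 \<Longrightarrow> z2 n $ i = resolvent (scale_op (\<sigma>' i) (inverse_op (D i)))
      (w2 n $ i + (\<sigma>' i / 2) *\<^sub>R L i (2 *\<^sub>R z1 n - w1 n))"
    and v: "\<And>n i. n \<ge> 1 \<Longrightarrow>
      v (n + 1) $ i = v n $ i + \<alpha>' n *\<^sub>R (v n $ i - v (n - 1) $ i)
        + lam' n *\<^sub>R (z2 n $ i - p2 n $ i)"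
  shows "\<exists>xb vb. (xb, vb) \<in> product_space G \<and>
    (let p1b = resolvent (scale_op \<tau> A)
           (xb - (\<tau> / 2) *\<^sub>R (\<Sum>i\<in>UNIV. adjoint (L i) (vb $ i)) + \<tau> *\<^sub>R z);
         p2b = (\<chi> i. resolvent (scale_op (\<sigma>' i) (inverse_op (B i)))
           (vb $ i + (\<sigma>' i / 2) *\<^sub>R L i (2 *\<^sub>R p1b - xb) - \<sigma>' i *\<^sub>R r i))
     in primal_dual_solution A B D L r z (p1b, p2b) \<and>
        (summable (\<lambda>n. (norm (x (n + 1) - x n))\<^sup>2) \<and>
         (\<forall>i. summable (\<lambda>n. (norm (v (n + 1) $ i - v n $ i))\<^sup>2))) \<and>
        weakly_converges_on (product_space G) (\<lambda>n. (x n, v n)) (xb, vb) \<and>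
        (\<lambda>n. (p1 n - z1 n, p2 n - z2 n)) \<longlonglongrightarrow> (0, 0) \<and>
        weakly_converges_on (product_space G) (\<lambda>n. (p1 n, p2 n)) (p1b, p2b) \<and>
        weakly_converges_on (product_space G) (\<lambda>n. (z1 n, z2 n)) (p1b, p2b) \<and>
        (uniformly_monotone A \<and> (\<forall>i. uniformly_monotone (inverse_op (B i))) \<longrightarrow>
          (\<lambda>n. (p1 n, p2 n)) \<longlonglongrightarrow> (p1b, p2b) \<and>
          (\<lambda>n. (z1 n, z2 n)) \<longlonglongrightarrow> (p1b, p2b) \<and>
          (\<forall>s. primal_dual_solution A B D L r z s \<longrightarrow> s = (p1b, p2b))))"
proof -
  interpret primal_dual_problem A z G r B D L \<tau> \<sigma>'
    by (rule primal_dual_problem.intro) (fact A G r B D L z \<tau> \<sigma>' \<tau>_\<sigma>')+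
  \<comment> \<open>From here on indices are shifted by one, to match the numbering of the abstract iteration.\<close>
  define u where "u = (\<lambda>n. (x n, v n))"
  define a where "a = (\<lambda>n. \<alpha>' (Suc n))"
  define w where "w = (\<lambda>n. u (Suc n) + a n *\<^sub>R (u (Suc n) - u n))"
  define p where "p = (\<lambda>n. (p1 (Suc n), p2 (Suc n)))"
  define q where "q = (\<lambda>n. (z1 (Suc n), z2 (Suc n)))"
  have w_eq: "w n = (x (Suc n) + \<alpha>' (Suc n) *\<^sub>R (x (Suc n) - x n),
      v (Suc n) + \<alpha>' (Suc n) *\<^sub>R (v (Suc n) - v n))" for n
    by (simp add: w_def u_def a_def)
  have p_eq: "p n = J1 (w n)" for n
  proof -
    have "p1 (Suc n) = JA (fst (w n) - (\<tau> / 2) *\<^sub>R Ls (snd (w n)) + \<tau> *\<^sub>R z)"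
      using p1[of "Suc n"] by (simp add: w_eq JA_def Ls_def)
    moreover have "p2 (Suc n) $ i = JB i (snd (w n) $ i
        + (\<sigma>' i / 2) *\<^sub>R L i (2 *\<^sub>R p1 (Suc n) - fst (w n)) - \<sigma>' i *\<^sub>R r i)" for i
      using p2[of "Suc n" i] w1[of "Suc n"] by (simp add: w_eq JB_def diff_diff_eq)
    ultimately show ?thesis
      by (simp add: p_def J1_def case_prod_beta Let_def vec_eq_iff)
  qed
  have q_eq: "q n = J2 (2 *\<^sub>R p n - w n)" for n
  proof -
    have w1': "fst (2 *\<^sub>R p n - w n) = w1 (Suc n)"
      using w1[of "Suc n"] by (simp add: p_def w_eq diff_diff_eq)
    have w2': "snd (2 *\<^sub>R p n - w n) = w2 (Suc n)"
      using w2[of "Suc n"] by (simp add: p_def w_eq vec_eq_iff diff_diff_eq)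
    have "z1 (Suc n) = w1 (Suc n) - (\<tau> / 2) *\<^sub>R Ls (w2 (Suc n))"
      using z1[of "Suc n"] by (simp add: Ls_def)
    moreover have "z2 (Suc n) $ i = JD i (w2 (Suc n) $ i
        + (\<sigma>' i / 2) *\<^sub>R L i (2 *\<^sub>R z1 (Suc n) - w1 (Suc n)))" for i
      using z2[of "Suc n" i] by (simp add: JD_def)
    ultimately show ?thesis
      unfolding J2_def case_prod_beta w1' w2' by (simp add: q_def Let_def vec_eq_iff)
  qed
  have u_step: "u (Suc (Suc n)) = w n + lam' (Suc n) *\<^sub>R (q n - p n)" for n
    using x[of "Suc n"] v[of "Suc n"] by (simp add: u_def w_eq q_def p_def vec_eq_iff)
  obtain c where pair: "firmly_nonexpansive_pair S V J1 J2 c" using J1_J2_pair by blast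
  interpret I: inertial_iteration S V J1 J2 c u w p q a "\<lambda>n. lam' (Suc n)" \<alpha> \<delta> \<sigma> lam
  proof (rule inertial_iteration.intro[OF pair], rule inertial_iteration_axioms.intro)
    show "u 0 \<in> S" "u (Suc 0) \<in> S" using v_init by (simp_all add: u_def mem_S)
    show "w n = u (Suc n) + a n *\<^sub>R (u (Suc n) - u n)" for n by (simp add: w_def)
    show "0 \<le> a n" "a n \<le> \<alpha>" for n using \<alpha>'_bounds[of "Suc n"] by (simp_all add: a_def)
    show "a n \<le> a (Suc n)" for n using \<alpha>'_mono by (auto simp: a_def intro: mono_onD)
    show "lam \<le> lam' (Suc n)" "lam' (Suc n) \<le> 2 * ((\<delta> - \<alpha> * (\<alpha> * (1 + \<alpha>) + \<alpha> * \<delta> + \<sigma>)) /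
        (\<delta> * (1 + \<alpha> * (1 + \<alpha>) + \<alpha> * \<delta> + \<sigma>)))" for n
      using lam'[of "Suc n"] by simp_all
  qed (fact p_eq q_eq u_step \<alpha> pos fixed_point_exists)+
  obtain ub where ub: "ub \<in> S" "J2 (2 *\<^sub>R J1 ub - ub) = J1 ub"
    and u_lim': "\<forall>y\<in>S. (\<lambda>n. u n \<bullet> y) \<longlonglongrightarrow> ub \<bullet> y"
    and p_lim': "\<forall>y\<in>S. (\<lambda>n. p n \<bullet> y) \<longlonglongrightarrow> J1 ub \<bullet> y"
    and q_lim': "\<forall>y\<in>S. (\<lambda>n. q n \<bullet> y) \<longlonglongrightarrow> J1 ub \<bullet> y"
    and strong: "(\<lambda>n. (p n - J1 ub) \<bullet> V ((w n - ub) - (p n - J1 ub))) \<longlonglongrightarrow> 0"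
    using I.weak_convergence by (elim bexE conjE)
  note u_lim = bspec[OF u_lim'] and p_lim = bspec[OF p_lim'] and q_lim = bspec[OF q_lim']
  have Jub: "J1 ub \<in> S" using ub(1) by (rule J1_inclusions)
  have weak: "weakly_converges_on S X l"
    if "l \<in> S" "\<And>n. Y n \<in> S" "\<And>y. y \<in> S \<Longrightarrow> (\<lambda>n. Y n \<bullet> y) \<longlonglongrightarrow> l \<bullet> y" "\<And>n. Y n = X (Suc n)"
    for X Y :: "nat \<Rightarrow> 'h \<times> ('g ^ 'm)" and l
    unfolding weakly_converges_on_def
  proof (intro conjI ballI)
    show "\<forall>\<^sub>F n in sequentially. X n \<in> S"
      using that(2) unfolding that(4) by (subst eventually_sequentially_Suc[symmetric]) simp
    show "(\<lambda>n. X n \<bullet> y) \<longlonglongrightarrow> l \<bullet> y" if "y \<in> S" for y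
      using \<open>\<And>y. y \<in> S \<Longrightarrow> (\<lambda>n. Y n \<bullet> y) \<longlonglongrightarrow> l \<bullet> y\<close>[OF that]
      unfolding \<open>\<And>n. Y n = X (Suc n)\<close> by (rule LIMSEQ_imp_Suc)
  qed (fact that(1))
  have "weakly_converges_on S (\<lambda>n. (x n, v n)) ub"
    by (rule weak[OF ub(1), of "\<lambda>n. u (Suc n)"])
      (use I.iterates_mem(1) LIMSEQ_Suc[OF u_lim] in \<open>auto simp: u_def\<close>)
  moreover have "weakly_converges_on S (\<lambda>n. (p1 n, p2 n)) (J1 ub)"
    by (rule weak[OF Jub I.iterates_mem(3) p_lim]) (auto simp: p_def)
  moreover have "weakly_converges_on S (\<lambda>n. (z1 n, z2 n)) (J1 ub)"
    by (rule weak[OF Jub I.iterates_mem(4) q_lim]) (auto simp: q_def)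
  moreover have residual: "(\<lambda>n. (p1 n - z1 n, p2 n - z2 n)) \<longlonglongrightarrow> (0, 0)"
  proof (rule LIMSEQ_imp_Suc)
    show "(\<lambda>n. (p1 (Suc n) - z1 (Suc n), p2 (Suc n) - z2 (Suc n))) \<longlonglongrightarrow> (0, 0)"
      using tendsto_minus[OF I.residual_tendsto_0] by (simp add: p_def q_def zero_prod_def)
  qed
  moreover have "summable (\<lambda>n. (norm (x (n + 1) - x n))\<^sup>2)"
    "summable (\<lambda>n. (norm (v (n + 1) $ i - v n $ i))\<^sup>2)" for i
  proof -
    have sum: "summable (\<lambda>n. (norm (u (Suc n) - u n))\<^sup>2)"
      using ub by (rule I.summable_and_distance_convergent)
    have "norm (x (n + 1) - x n) \<le> norm (u (Suc n) - u n)" for n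
      using norm_fst_le[of "x (Suc n) - x n" "v (Suc n) - v n"] by (simp add: u_def)
    then show "summable (\<lambda>n. (norm (x (n + 1) - x n))\<^sup>2)"
      by (intro summable_comparison_test'[OF sum]) (auto intro: power_mono)
    have "norm (v (n + 1) $ i - v n $ i) \<le> norm (u (Suc n) - u n)" for n
      using norm_snd_le[of "v (Suc n) - v n" "x (Suc n) - x n"]
        Finite_Cartesian_Product.norm_nth_le[of "v (Suc n) - v n" i] by (simp add: u_def)
    then show "summable (\<lambda>n. (norm (v (n + 1) $ i - v n $ i))\<^sup>2)"
      by (intro summable_comparison_test'[OF sum]) (auto intro: power_mono)
  qed
  moreover have "primal_dual_solution A B D L r z (J1 ub)"
    using ub by (rule fixed_point_solution)
  moreover have "(\<lambda>n. (p1 n, p2 n)) \<longlonglongrightarrow> J1 ub \<and> (\<lambda>n. (z1 n, z2 n)) \<longlonglongrightarrow> J1 ub \<and>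
      (\<forall>s. primal_dual_solution A B D L r z s \<longrightarrow> s = J1 ub)"
    if um: "uniformly_monotone A \<and> (\<forall>i. uniformly_monotone (inverse_op (B i)))"
  proof (intro conjI allI impI)
    have um': "uniformly_monotone A" "\<And>i. uniformly_monotone (inverse_op (B i))"
      using um by auto
    have "(\<lambda>n. J1 (w n)) \<longlonglongrightarrow> J1 ub"
      using uniformly_monotone_J1_convergence[OF um' I.iterates_mem(2) ub(1)] strong
      by (simp add: p_eq)
    then have "(\<lambda>n. (p1 (Suc n), p2 (Suc n))) \<longlonglongrightarrow> J1 ub" by (simp add: p_def flip: p_eq)
    then show p_strong: "(\<lambda>n. (p1 n, p2 n)) \<longlonglongrightarrow> J1 ub" by (rule LIMSEQ_imp_Suc)
    show "(\<lambda>n. (z1 n, z2 n)) \<longlonglongrightarrow> J1 ub"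
      using tendsto_diff[OF p_strong residual] by (simp flip: zero_prod_def)
    show "s = J1 ub" if "primal_dual_solution A B D L r z s" for s
      using uniformly_monotone_solution_unique[OF um' that] ub fixed_point_solution by blast
  qed
  ultimately have main: "primal_dual_solution A B D L r z (J1 ub) \<and>
      (summable (\<lambda>n. (norm (x (n + 1) - x n))\<^sup>2) \<and>
        (\<forall>i. summable (\<lambda>n. (norm (v (n + 1) $ i - v n $ i))\<^sup>2))) \<and>
      weakly_converges_on S (\<lambda>n. (x n, v n)) ub \<and>
      (\<lambda>n. (p1 n - z1 n, p2 n - z2 n)) \<longlonglongrightarrow> (0, 0) \<and>
      weakly_converges_on S (\<lambda>n. (p1 n, p2 n)) (J1 ub) \<and>
      weakly_converges_on S (\<lambda>n. (z1 n, z2 n)) (J1 ub) \<and>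
      (uniformly_monotone A \<and> (\<forall>i. uniformly_monotone (inverse_op (B i))) \<longrightarrow>
        (\<lambda>n. (p1 n, p2 n)) \<longlonglongrightarrow> J1 ub \<and> (\<lambda>n. (z1 n, z2 n)) \<longlonglongrightarrow> J1 ub \<and>
        (\<forall>s. primal_dual_solution A B D L r z s \<longrightarrow> s = J1 ub))"
    by blast
  obtain xb vb where ub_eq: "ub = (xb, vb)" by (cases ub)
  show ?thesis
    using main ub(1) unfolding ub_eq J1_def JA_def JB_def Ls_def case_prod_conv Let_def by blast
qed

end
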